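(* Let $n\ge2$, $c>0$ and $d\mu=e^{c|x|^2}dx$ on $\mathbb R^n$; write $\|g\|_p=(\int_{\mathbb R^n}|g|^p\,d\mu)^{1/p}$ (and $\|g\|_\infty$ the sup norm). Let $p\in[1,\infty)$ and let $q\in[p,np/(n-p)]$ if $p<n$, $q\in[n,\infty)$ if $p=n$, and $q\in[p,\infty]$ if $p>n$. Then there is a constant $C(p,q)>0$ such that $$\|\nabla u\|_p\ge C(p,q)\|u\|_q\qquad\text{for all } u\in C_0^\infty(\mathbb R^n).$$ Moreover, for $p\in(n,\infty)$ there is a constant $C(p)>0$ such that $\|\nabla u\|_p\ge C(p)\|u\|_{C^{0,1-n/p}(\mathbb R^n)}$ for all $u\in C_0^\infty(\mathbb R^n)$.
   Context: $\|\nabla u\|_p$ means $\|\,|\nabla u|\,\|_p$ with respect to $\mu$. $C^{0,\alpha}(\mathbb R^n)$ denotes the space of $\alpha$-Hölder continuous functions with its usual norm. *)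

theory Defs
  imports "HOL-Analysis.Analysis"
begin

definition pdiff :: "'n::finite \<Rightarrow> (real^'n \<Rightarrow> real) \<Rightarrow> real^'n \<Rightarrow> real" where
  "pdiff i f x = frechet_derivative f (at x) (axis i 1)"

definition grad :: "(real^'n::finite \<Rightarrow> real) \<Rightarrow> real^'n \<Rightarrow> real^'n" where
  "grad u x = (\<chi> i. pdiff i u x)"

definition smooth :: "(real^'n::finite \<Rightarrow> real) \<Rightarrow> bool" where
  "smooth f \<longleftrightarrow> (\<forall>is::'n list. \<forall>x. foldr pdiff is f differentiable (at x))"

definition Ccinf :: "(real^'n::finite \<Rightarrow> real) set" where
  "Ccinf = {u. smooth u \<and> compact (closure {x. u x \<noteq> 0})}"

definition gauss_measure :: "real \<Rightarrow> (real^'n::finite) measure" where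
  "gauss_measure c = density lborel (\<lambda>x. ennreal (exp (c * norm x ^ 2)))"

definition Lp_norm :: "'a measure \<Rightarrow> real \<Rightarrow> ('a \<Rightarrow> real) \<Rightarrow> real" where
  "Lp_norm M p g = (\<integral>x. \<bar>g x\<bar> powr p \<partial>M) powr (1 / p)"

definition sup_norm :: "('a \<Rightarrow> real) \<Rightarrow> real" where
  "sup_norm g = (SUP x. \<bar>g x\<bar>)"

definition holder_norm :: "real \<Rightarrow> (real^'n::finite \<Rightarrow> real) \<Rightarrow> real" where
  "holder_norm \<alpha> g = sup_norm g +
     (SUP xy\<in>{(x,y). x \<noteq> y}. \<bar>g (fst xy) - g (snd xy)\<bar> / dist (fst xy) (snd xy) powr \<alpha>)"

end

theory Submission
  imports Defs
begin

text \<open>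
  The weight increases in every \<open>|x\<^sub>i|\<close>. So if the fundamental theorem of calculus is applied along
  the \<open>i\<close>-th axis and away from the origin, it gives
  \<open>|u(x)|\<^bsup>\<gamma>\<^esup> \<le> \<integral> \<gamma> |u|\<^bsup>\<gamma>-1\<^esup> |\<nabla>u|\<close> over \<open>|t| \<ge> |x\<^sub>i|\<close>, and the weight at \<open>x\<close> may be moved under
  the integral. The Gagliardo-Nirenberg argument then applies to \<open>e\<^bsup>c|x|\<^sup>2\<^esup>|u|\<^bsup>\<gamma>\<^esup>\<close> as in the unweighted
  case, and integrating in \<open>x\<^sub>i\<close> as well gives a Poincare inequality, because
  \<open>\<integral> e\<^bsup>c(s\<^sup>2-t\<^sup>2)\<^esup> ds\<close> over \<open>|s| \<le> |t|\<close> is bounded in \<open>t\<close>. With Hoelder's inequality, the choice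
  \<open>\<gamma> = p(n-1)/(n-p)\<close> yields the critical exponent for \<open>p < n\<close>; for \<open>p = n\<close> each application
  raises the exponent by \<open>n/(n-1)\<close>, so all exponents are reached. Intermediate exponents follow
  from \<open>|u|\<^bsup>q\<^esup> \<le> G\<^bsup>q-a\<^esup>|u|\<^bsup>a\<^esup> + G\<^bsup>q-b\<^esup>|u|\<^bsup>b\<^esup>\<close> with \<open>G = \<parallel>\<nabla>u\<parallel>\<^sub>p\<close>. For \<open>p > n\<close> the weight is at least
  \<open>1\<close>, so the unweighted Morrey estimate bounds the Hoelder seminorm, and averaging it over unit
  balls bounds the supremum by the Poincare inequality.\<close>

section \<open>Hoelder's inequality and integrals over lines\<close>

text \<open>Unlike \<open>powr\<close>, this power has \<open>x\<^sup>0 = 1\<close> also at \<open>x = 0\<close> and \<open>x = \<infinity>\<close>; the case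
  \<open>\<gamma> = 1\<close> of \<open>|u|\<^bsup>\<gamma>-1\<^esup>\<close> and the vanishing exponents in Hoelder's inequality depend on it.\<close>

definition epowr :: "ennreal \<Rightarrow> real \<Rightarrow> ennreal" where
  "epowr x a = (if a = 0 then 1 else if x = top then top else ennreal (enn2real x powr a))"

lemma epowr_0 [simp]: "epowr x 0 = 1"
  by (simp add: epowr_def)

lemma epowr_top [simp]: "a \<noteq> 0 \<Longrightarrow> epowr top a = top"
  by (simp add: epowr_def)

lemma epowr_ennreal: "0 \<le> r \<Longrightarrow> a \<noteq> 0 \<Longrightarrow> epowr (ennreal r) a = ennreal (r powr a)"
  by (simp add: epowr_def)

lemma epowr_ennreal_pos: "0 < r \<Longrightarrow> epowr (ennreal r) a = ennreal (r powr a)"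
  by (simp add: epowr_def)

lemma epowr_zero [simp]: "a \<noteq> 0 \<Longrightarrow> epowr 0 a = 0"
  by (simp add: epowr_def)

lemma epowr_1 [simp]: "epowr x 1 = x"
  by (cases x) (auto simp: epowr_def)

lemma measurable_epowr [measurable]: "(\<lambda>x. epowr x a) \<in> borel_measurable borel"
  unfolding epowr_def by measurable

lemma borel_measurable_epowr [measurable (raw)]:
  "f \<in> borel_measurable M \<Longrightarrow> (\<lambda>x. epowr (f x) a) \<in> borel_measurable M"
  using measurable_compose[OF _ measurable_epowr] by blast

lemma epowr_mono: "0 \<le> a \<Longrightarrow> x \<le> y \<Longrightarrow> epowr x a \<le> epowr y a"
  by (cases x; cases y) (auto simp: epowr_def top_unique intro!: ennreal_leI powr_mono2)

lemma epowr_add: "0 \<le> a \<Longrightarrow> 0 \<le> b \<Longrightarrow> epowr x a * epowr x b = epowr x (a + b)"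
  by (cases x) (auto simp: epowr_def ennreal_mult[symmetric] powr_add)

lemma epowr_mult: "0 \<le> a \<Longrightarrow> epowr (x * y) a = epowr x a * epowr y a"
  by (cases x; cases y) (auto simp: epowr_def ennreal_mult[symmetric] powr_mult ennreal_mult_top ennreal_top_mult ennreal_mult_eq_top_iff)

lemma epowr_eq_0_iff: "epowr x a = 0 \<longleftrightarrow> a \<noteq> 0 \<and> x = 0"
  by (cases x) (auto simp: epowr_def ennreal_eq_0_iff)

lemma epowr_prod_const: "finite I \<Longrightarrow> 0 \<le> a \<Longrightarrow> (\<Prod>i\<in>I. epowr x a) = epowr x (real (card I) * a)"
  by (induction I rule: finite_induct) (auto simp: epowr_add algebra_simps)

section \<open>Weighted arithmetic-geometric means and Hoelder's inequality\<close>

lemma weighted_arith_geom_mean: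
  fixes a x :: "'i \<Rightarrow> real"
  assumes "finite J" "\<And>j. j \<in> J \<Longrightarrow> 0 < a j" "sum a J = 1" "\<And>j. j \<in> J \<Longrightarrow> 0 \<le> x j"
  shows "(\<Prod>j\<in>J. x j powr a j) \<le> (\<Sum>j\<in>J. a j * x j)"
proof (cases "\<exists>j\<in>J. x j = 0")
  case True
  then have "(\<Prod>j\<in>J. x j powr a j) = 0"
    using assms(1) by (auto simp: prod_zero_iff)
  moreover have "0 \<le> (\<Sum>j\<in>J. a j * x j)"
    using assms by (intro sum_nonneg mult_nonneg_nonneg) (auto intro: less_imp_le)
  ultimately show ?thesis by simp
next
  case False
  then have pos: "0 < x j" if "j \<in> J" for j
    using assms(4) that by (metis less_eq_real_def)
  have "J \<noteq> {}" using assms(3) by auto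
  \<comment> \<open>Jensen's inequality for the convex function \<open>exp\<close> at the points
    \<open>ln (x j)\<close>; zero entries were split off because the logarithm needs positive
    arguments.\<close>
  have "(\<Prod>j\<in>J. x j powr a j) = exp (\<Sum>j\<in>J. a j *\<^sub>R ln (x j))"
    using assms(1) by (simp add: exp_sum) (intro prod.cong refl, use pos in \<open>force simp: powr_def\<close>)
  also have "\<dots> \<le> (\<Sum>j\<in>J. a j * exp (ln (x j)))"
    using assms \<open>J \<noteq> {}\<close> by (intro convex_on_sum[OF _ _ exp_convex]) (auto intro: less_imp_le)
  also have "\<dots> = (\<Sum>j\<in>J. a j * x j)"
    using pos by (intro sum.cong) auto
  finally show ?thesis .
qed

text \<open>An infinite entry makes the right side infinite because every weight is positive;
  otherwise all entries are real numbers and the inequality for reals applies.\<close>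

lemma epowr_weighted_arith_geom_mean:
  assumes J: "finite J" and a: "\<And>j. j \<in> J \<Longrightarrow> 0 < a j" and s: "sum a J = 1"
  shows "(\<Prod>j\<in>J. epowr (x j) (a j)) \<le> (\<Sum>j\<in>J. ennreal (a j) * x j)"
proof (cases "\<exists>j\<in>J. x j = top")
  case True
  then obtain j where j: "j \<in> J" "x j = top" by auto
  then have "ennreal (a j) * x j = top"
    using a[of j] by (simp add: ennreal_mult_top)
  then have "(\<Sum>j\<in>J. ennreal (a j) * x j) = top"
    using J j by (subst sum.remove[of J j]) auto
  then show ?thesis by simp
next
  case False
  define y where "y j = enn2real (x j)" for j
  have x: "x j = ennreal (y j)" and y0: "0 \<le> y j" if "j \<in> J" for j
    using False that by (auto simp: y_def less_top)
  have "(\<Prod>j\<in>J. epowr (x j) (a j)) = (\<Prod>j\<in>J. ennreal (y j powr a j))"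
    using x y0 a by (intro prod.cong refl) (metis epowr_ennreal less_irrefl)
  also have "\<dots> = ennreal (\<Prod>j\<in>J. y j powr a j)"
    by (intro prod_ennreal) auto
  also have "\<dots> \<le> ennreal (\<Sum>j\<in>J. a j * y j)"
    using J a s y0 by (intro ennreal_leI weighted_arith_geom_mean)
  also have "\<dots> = (\<Sum>j\<in>J. ennreal (a j * y j))"
    using a y0 by (intro sum_ennreal[symmetric] mult_nonneg_nonneg less_imp_le[OF a])
  also have "\<dots> = (\<Sum>j\<in>J. ennreal (a j) * x j)"
    using a y0 x by (intro sum.cong refl) (auto simp: ennreal_mult less_imp_le)
  finally show ?thesis .
qed

text \<open>Each \<open>h j\<close> is divided by its integral, so that the weighted mean
  inequality, applied pointwise and then integrated, leaves \<open>sum a J = 1\<close>. Only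
  integrals that are 0 or infinite resist this normalization and are treated apart.\<close>

lemma generalized_Holder_pos:
  assumes J: "finite J" and a: "\<And>j. j \<in> J \<Longrightarrow> 0 < a j" and s: "sum a J = 1"
    and h [measurable]: "\<And>j. j \<in> J \<Longrightarrow> h j \<in> borel_measurable M"
  shows "(\<integral>\<^sup>+x. (\<Prod>j\<in>J. epowr (h j x) (a j)) \<partial>M) \<le> (\<Prod>j\<in>J. epowr (\<integral>\<^sup>+x. h j x \<partial>M) (a j))"
proof -
  define H where "H j = (\<integral>\<^sup>+x. h j x \<partial>M)" for j
  \<comment> \<open>A vanishing integral takes precedence over an infinite one: if both occur, the
    right side is \<open>0 * top = 0\<close>. The infinite case therefore assumes that no integral
    vanishes.\<close>
  consider (zero) "\<exists>j\<in>J. H j = 0" | (top) "\<exists>j\<in>J. H j = top" "\<forall>j\<in>J. H j \<noteq> 0"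
    | (fin) "\<forall>j\<in>J. H j \<noteq> 0 \<and> H j \<noteq> top" by blast
  then show ?thesis
  proof cases
    case zero
    then obtain j where j: "j \<in> J" "H j = 0" by auto
    then have "AE x in M. h j x = 0"
      using h[OF j(1)] by (simp add: H_def nn_integral_0_iff_AE)
    then have "AE x in M. (\<Prod>j\<in>J. epowr (h j x) (a j)) = 0"
    proof eventually_elim
      case (elim x)
      then have "epowr (h j x) (a j) = 0" using a[OF j(1)] by simp
      then show ?case using J j(1) by (auto simp: prod_zero_iff)
    qed
    then have "(\<integral>\<^sup>+x. (\<Prod>j\<in>J. epowr (h j x) (a j)) \<partial>M) = 0"
      by (subst nn_integral_0_iff_AE) auto
    then show ?thesis by simp
  next
    case top
    then obtain j where j: "j \<in> J" "H j = top" by auto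
    have "(\<Prod>j\<in>J. epowr (H j) (a j)) = top"
    proof -
      have "epowr (H j) (a j) = top" using j a[OF j(1)] by simp
      moreover have "(\<Prod>i\<in>J - {j}. epowr (H i) (a i)) \<noteq> 0"
        using J top by (auto simp: prod_zero_iff epowr_eq_0_iff)
      ultimately show ?thesis
        by (subst prod.remove[OF J j(1)]) (simp add: ennreal_top_mult)
    qed
    then show ?thesis by (simp add: H_def)
  next
    case fin
    define k where "k j = enn2real (H j)" for j
    have k: "H j = ennreal (k j)" "0 < k j" if "j \<in> J" for j
    proof -
      have "H j \<noteq> 0" "H j < top" using fin that by (auto simp: less_top)
      then show "H j = ennreal (k j)" "0 < k j"
        by (auto simp: k_def enn2real_positive_iff zero_less_iff_neq_zero)
    qed
    have eq: "h j x = H j * (ennreal (1 / k j) * h j x)" if "j \<in> J" for j x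
    proof -
      have "H j * (ennreal (1 / k j) * h j x) = ennreal (k j * (1 / k j)) * h j x"
        using k[OF that] by (subst ennreal_mult) (auto simp: mult.assoc)
      then show ?thesis using k[OF that] by simp
    qed
    have "(\<Prod>j\<in>J. epowr (h j x) (a j)) \<le> (\<Prod>j\<in>J. epowr (H j) (a j)) * (\<Sum>j\<in>J. ennreal (a j) * (ennreal (1 / k j) * h j x))" for x
    proof -
      have "(\<Prod>j\<in>J. epowr (h j x) (a j)) = (\<Prod>j\<in>J. epowr (H j) (a j) * epowr (ennreal (1 / k j) * h j x) (a j))"
        using a eq by (intro prod.cong refl) (metis epowr_mult less_imp_le)
      also have "\<dots> = (\<Prod>j\<in>J. epowr (H j) (a j)) * (\<Prod>j\<in>J. epowr (ennreal (1 / k j) * h j x) (a j))"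
        by (rule prod.distrib)
      also have "\<dots> \<le> (\<Prod>j\<in>J. epowr (H j) (a j)) * (\<Sum>j\<in>J. ennreal (a j) * (ennreal (1 / k j) * h j x))"
        by (intro mult_left_mono epowr_weighted_arith_geom_mean J a s) auto
      finally show ?thesis .
    qed
    then have "(\<integral>\<^sup>+x. (\<Prod>j\<in>J. epowr (h j x) (a j)) \<partial>M)
        \<le> (\<integral>\<^sup>+x. (\<Prod>j\<in>J. epowr (H j) (a j)) * (\<Sum>j\<in>J. ennreal (a j) * (ennreal (1 / k j) * h j x)) \<partial>M)"
      by (intro nn_integral_mono)
    also have "\<dots> = (\<Prod>j\<in>J. epowr (H j) (a j)) * (\<Sum>j\<in>J. ennreal (a j) * (ennreal (1 / k j) * H j))"
      by (simp add: nn_integral_cmult nn_integral_sum H_def)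
    also have "(\<Sum>j\<in>J. ennreal (a j) * (ennreal (1 / k j) * H j)) = (\<Sum>j\<in>J. ennreal (a j))"
    proof (intro sum.cong refl)
      fix j assume j: "j \<in> J"
      have "ennreal (1 / k j) * H j = ennreal (1 / k j * k j)"
        using k[OF j] by (subst ennreal_mult) auto
      then show "ennreal (a j) * (ennreal (1 / k j) * H j) = ennreal (a j)"
        using k(2)[OF j] by simp
    qed
    also have "\<dots> = 1"
      using a s by (subst sum_ennreal) (auto simp: less_imp_le)
    finally show ?thesis by (simp add: H_def)
  qed
qed

lemma generalized_Holder:
  assumes J: "finite J" and a: "\<And>j. j \<in> J \<Longrightarrow> 0 \<le> a j" and s: "sum a J = 1"
    and h: "\<And>j. j \<in> J \<Longrightarrow> h j \<in> borel_measurable M"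
  shows "(\<integral>\<^sup>+x. (\<Prod>j\<in>J. epowr (h j x) (a j)) \<partial>M) \<le> (\<Prod>j\<in>J. epowr (\<integral>\<^sup>+x. h j x \<partial>M) (a j))"
proof -
  let ?J = "{j\<in>J. a j \<noteq> 0}"
  have eq: "(\<Prod>j\<in>J. epowr (g j) (a j)) = (\<Prod>j\<in>?J. epowr (g j) (a j))" for g
    using J by (intro prod.mono_neutral_right) auto
  have "sum a ?J = sum a J"
    using J by (intro sum.mono_neutral_left) auto
  then show ?thesis
    unfolding eq using J a s h by (intro generalized_Holder_pos) (auto simp: order.strict_iff_order)
qed

lemma Holder_nn_integral:
  assumes a: "0 \<le> a" "0 \<le> b" "a + b = 1"
    and [measurable]: "f \<in> borel_measurable M" "g \<in> borel_measurable M"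
  shows "(\<integral>\<^sup>+x. epowr (f x) a * epowr (g x) b \<partial>M) \<le> epowr (\<integral>\<^sup>+x. f x \<partial>M) a * epowr (\<integral>\<^sup>+x. g x \<partial>M) b"
  using generalized_Holder[of "UNIV :: bool set" "\<lambda>j. if j then a else b" "\<lambda>j. if j then f else g" M] a
  by (simp add: UNIV_bool if_distrib mult.commute add.commute cong: if_cong)

section \<open>Products of line integrals on a grid\<close>

context product_sigma_finite
begin

text \<open>Induction on \<open>I\<close>: integrate out the new coordinate by Hoelder's inequality with exponents
  \<open>1 - kp\<close> and \<open>k\<close> times \<open>p\<close>, where \<open>k = card I\<close>; what remains is the claim for the partial
  integral of \<open>f\<close>. For \<open>p = 1 / (card I - 1)\<close> the first factor disappears, which is
  the Gagliardo-Nirenberg form.\<close>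

lemma grid_lines_inequality:
  fixes f :: "('i \<Rightarrow> 'a) \<Rightarrow> ennreal"
  assumes "finite I" "f \<in> borel_measurable (Pi\<^sub>M I M)" "0 \<le> p" "(real (card I) - 1) * p \<le> 1"
  shows "(\<integral>\<^sup>+x. epowr (f x) (1 - (real (card I) - 1) * p) *
            (\<Prod>i\<in>I. epowr (\<integral>\<^sup>+t. f (x(i := t)) \<partial>M i) p) \<partial>Pi\<^sub>M I M)
         \<le> epowr (\<integral>\<^sup>+x. f x \<partial>Pi\<^sub>M I M) (1 + p)"
  using assms
proof (induction I arbitrary: f rule: finite_induct)
  case empty
  \<comment> \<open>With no coordinates the first exponent is
    \<open>1 - (0 - 1) * p = 1 + p\<close>, so both sides are the same power of the value of
    \<open>f\<close> at the only point.\<close>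
  then show ?case by (simp add: PiM_empty nn_integral_count_space_finite)
next
  case (insert i I)
  interpret sigma_finite_measure "M j" for j by (rule sigma_finite_measures)
  note [measurable] = insert.prems(1)
  define k where "k = real (card I)"
  have card: "real (card (insert i I)) - 1 = k"
    using insert.hyps by (simp add: k_def)
  have kp: "k * p \<le> 1" "0 \<le> p" using insert.prems card by auto
  have k0: "0 \<le> k" by (simp add: k_def)
  define g where "g x = (\<integral>\<^sup>+t. f (x(i := t)) \<partial>M i)" for x
  have g [measurable]: "g \<in> borel_measurable (Pi\<^sub>M I M)"
    unfolding g_def by measurable
  have meas: "(\<lambda>(t, s). f (x(i := t, j := s))) \<in> borel_measurable (M i \<Otimes>\<^sub>M M j)"
    if "x \<in> space (Pi\<^sub>M I M)" "j \<in> I" for x j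
  proof -
    have "(\<lambda>(t, s). x(i := t, j := s)) \<in> measurable (M i \<Otimes>\<^sub>M M j) (Pi\<^sub>M (insert i I) M)"
      unfolding split_beta' using that
      by (intro measurable_fun_upd[where J="insert i I"] measurable_fun_upd[where J=I])
        (auto simp: space_PiM PiE_iff)
    from measurable_compose[OF this insert.prems(1)] show ?thesis by (simp only: split_beta')
  qed
  have [measurable]: "(\<lambda>x. \<integral>\<^sup>+t. f (x(j := t)) \<partial>M j) \<in> borel_measurable (Pi\<^sub>M (insert i I) M)"
    if "j \<in> insert i I" for j
  proof -
    have "(\<lambda>w. (fst w)(j := snd w)) \<in> measurable (Pi\<^sub>M (insert i I) M \<Otimes>\<^sub>M M j) (Pi\<^sub>M (insert i I) M)"
      using that by (intro measurable_fun_upd[where J="insert i I"]) auto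
    from measurable_compose[OF this insert.prems(1)] show ?thesis
      by (intro borel_measurable_nn_integral) (simp only: split_beta')
  qed
  have "(\<integral>\<^sup>+x. epowr (f x) (1 - k * p) * (\<Prod>j\<in>insert i I. epowr (\<integral>\<^sup>+t. f (x(j := t)) \<partial>M j) p) \<partial>Pi\<^sub>M (insert i I) M)
      = (\<integral>\<^sup>+x. \<integral>\<^sup>+t. epowr (f (x(i := t))) (1 - k * p) *
           (\<Prod>j\<in>insert i I. epowr (\<integral>\<^sup>+s. f (x(i := t, j := s)) \<partial>M j) p) \<partial>M i \<partial>Pi\<^sub>M I M)"
    by (subst product_nn_integral_insert[OF insert.hyps(1,2)])
      (intro borel_measurable_times_ennreal borel_measurable_prod_ennreal borel_measurable_epowr, auto)
  also have "\<dots> \<le> (\<integral>\<^sup>+x. epowr (g x) (1 - (k - 1) * p) * (\<Prod>j\<in>I. epowr (\<integral>\<^sup>+s. g (x(j := s)) \<partial>M j) p) \<partial>Pi\<^sub>M I M)"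
  proof (rule nn_integral_mono)
    fix x assume x: "x \<in> space (Pi\<^sub>M I M)"
    define h where "h j t = (if j = i then f (x(i := t)) else (\<integral>\<^sup>+s. f (x(i := t, j := s)) \<partial>M j))" for j t
    define a where "a j = (if j = i then 1 - k * p else p)" for j
    have upd: "(\<lambda>t. f (x(i := t))) \<in> borel_measurable (M i)"
      using x by measurable
    have h: "h j \<in> borel_measurable (M i)" if "j \<in> insert i I" for j
    proof (cases "j = i")
      case False
      then show ?thesis using that meas[OF x, of j] unfolding h_def
        by (auto intro!: borel_measurable_nn_integral)
    qed (use upd in \<open>simp add: h_def[abs_def]\<close>)
    have H: "(\<integral>\<^sup>+t. h j t \<partial>M i) = (if j = i then g x else (\<integral>\<^sup>+s. g (x(j := s)) \<partial>M j))" if "j \<in> insert i I" for j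
    proof (cases "j = i")
      case False
      interpret pair_sigma_finite "M i" "M j" ..
      have "j \<in> I" using that False by simp
      have "(\<integral>\<^sup>+t. h j t \<partial>M i) = (\<integral>\<^sup>+s. (\<integral>\<^sup>+t. f (x(i := t, j := s)) \<partial>M i) \<partial>M j)"
        using False Fubini'[OF meas[OF x \<open>j \<in> I\<close>]] by (simp add: h_def)
      then show ?thesis using False by (simp add: g_def fun_upd_twist)
    qed (simp add: h_def g_def)
    have [measurable]: "(\<lambda>t. \<Prod>j\<in>insert i I. epowr (h j t) (a j)) \<in> borel_measurable (M i)"
      using h by (intro borel_measurable_prod_ennreal borel_measurable_epowr) auto
    have pi: "(\<Prod>j\<in>insert i I. epowr (F j) (a j)) = epowr (F i) (1 - k * p) * (\<Prod>j\<in>I. epowr (F j) p)" for F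
      using insert.hyps by (auto simp: a_def intro!: arg_cong[where f="\<lambda>z. _ * z"] prod.cong)
    \<comment> \<open>The line integral in the direction \<open>i\<close> does not depend on
      \<open>t\<close>; it equals \<open>g x\<close> and leaves the integral before Hoelder's
      inequality is applied to the other factors.\<close>
    have "(\<integral>\<^sup>+t. epowr (f (x(i := t))) (1 - k * p) *
             (\<Prod>j\<in>insert i I. epowr (\<integral>\<^sup>+s. f (x(i := t, j := s)) \<partial>M j) p) \<partial>M i)
        = (\<integral>\<^sup>+t. epowr (g x) p * (\<Prod>j\<in>insert i I. epowr (h j t) (a j)) \<partial>M i)"
      unfolding pi using insert.hyps
      by (auto simp: h_def g_def ac_simps intro!: nn_integral_cong arg_cong[where f="\<lambda>z. _ * z"] prod.cong)
    also have "\<dots> = epowr (g x) p * (\<integral>\<^sup>+t. (\<Prod>j\<in>insert i I. epowr (h j t) (a j)) \<partial>M i)"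
      by (rule nn_integral_cmult) measurable
    also have "\<dots> \<le> epowr (g x) p * (\<Prod>j\<in>insert i I. epowr (\<integral>\<^sup>+t. h j t \<partial>M i) (a j))"
    proof (intro mult_left_mono generalized_Holder h)
      have "sum a I = (\<Sum>j\<in>I. p)"
        using insert.hyps by (intro sum.cong) (auto simp: a_def)
      then have "sum a (insert i I) = 1 - k * p + (\<Sum>j\<in>I. p)"
        using insert.hyps by (simp add: a_def[of i])
      then show "sum a (insert i I) = 1" by (simp add: k_def)
    qed (use kp insert.hyps in \<open>auto simp: a_def\<close>)
    also have "\<dots> = epowr (g x) p * (epowr (g x) (1 - k * p) * (\<Prod>j\<in>I. epowr (\<integral>\<^sup>+s. g (x(j := s)) \<partial>M j) p))"
      unfolding pi using insert.hyps H
      by (auto intro!: arg_cong[where f="\<lambda>z. _ * (_ * z)"] prod.cong)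
    \<comment> \<open>The exponents \<open>p\<close> and \<open>1 - k * p\<close> of
      \<open>g x\<close> add up to \<open>1 - (k - 1) * p\<close>, the one that the induction
      hypothesis has for \<open>k\<close> coordinates.\<close>
    also have "\<dots> = epowr (g x) (1 - (k - 1) * p) * (\<Prod>j\<in>I. epowr (\<integral>\<^sup>+s. g (x(j := s)) \<partial>M j) p)"
      using kp by (simp add: mult.assoc[symmetric] epowr_add algebra_simps)
    finally show "(\<integral>\<^sup>+t. epowr (f (x(i := t))) (1 - k * p) *
             (\<Prod>j\<in>insert i I. epowr (\<integral>\<^sup>+s. f (x(i := t, j := s)) \<partial>M j) p) \<partial>M i)
        \<le> epowr (g x) (1 - (k - 1) * p) * (\<Prod>j\<in>I. epowr (\<integral>\<^sup>+s. g (x(j := s)) \<partial>M j) p)" .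
  qed
  also have "\<dots> \<le> epowr (\<integral>\<^sup>+x. g x \<partial>Pi\<^sub>M I M) (1 + p)"
    unfolding k_def using kp by (intro insert.IH g) (auto simp: k_def algebra_simps)
  also have "(\<integral>\<^sup>+x. g x \<partial>Pi\<^sub>M I M) = (\<integral>\<^sup>+x. f x \<partial>Pi\<^sub>M (insert i I) M)"
    unfolding g_def by (rule product_nn_integral_insert[symmetric, OF insert.hyps]) measurable
  finally show ?case unfolding card .
qed

end

section \<open>Slices of Euclidean space\<close>

definition vupd :: "real^'n \<Rightarrow> 'n \<Rightarrow> real \<Rightarrow> real^'n" where
  "vupd x i t = (\<chi> j. if j = i then t else x $ j)"

lemma vupd_nth [simp]: "vupd x i t $ j = (if j = i then t else x $ j)"
  by (simp add: vupd_def)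

lemma vupd_vec_lambda: "vupd (vec_lambda f) i t = vec_lambda (f(i := t))"
  by (simp add: vec_eq_iff)

lemma vupd_triv [simp]: "vupd x i (x $ i) = x"
  by (simp add: vec_eq_iff)

lemma vupd_eq_line: "vupd x i = (\<lambda>t. (x - (x $ i) *\<^sub>R axis i 1) + t *\<^sub>R axis i 1)"
  by (auto simp: fun_eq_iff vec_eq_iff axis_def)

text \<open>Along a coordinate line the Gaussian weight varies only through
  \<open>t\<^sup>2\<close>; this allows the weights at two points of the line to be
  compared.\<close>

lemma norm_vupd_power2: "(norm (vupd x i t))\<^sup>2 = (norm x)\<^sup>2 - (x $ i)\<^sup>2 + t\<^sup>2"
  for x :: "real^'n::finite"
proof -
  have "(norm y)\<^sup>2 = (y $ i)\<^sup>2 + (\<Sum>j\<in>UNIV - {i}. (y $ j)\<^sup>2)" for y :: "real^'n"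
    by (simp add: norm_vec_def L2_set_def sum_nonneg sum.remove[of UNIV i])
  from this[of x] this[of "vupd x i t"] show ?thesis by simp
qed

lemma abs_le_norm_vupd: "\<bar>t\<bar> \<le> norm (vupd x i t)"
  for x :: "real^'n::finite"
  using component_le_norm_cart[of "vupd x i t" i] by simp

interpretation lborel_product: product_sigma_finite "\<lambda>_. lborel :: real measure"
  by standard

lemma measurable_vec_lambda [measurable]:
  "vec_lambda \<in> measurable (Pi\<^sub>M (UNIV :: 'n::finite set) (\<lambda>_. lborel :: real measure)) (borel :: (real^'n) measure)"
proof (rule borel_measurable_euclidean_space[THEN iffD2], rule ballI)
  fix b :: "real^'n" assume "b \<in> Basis"
  then obtain i where "b = axis i 1" by (auto simp: Basis_vec_def)
  then have eq: "vec_lambda f \<bullet> b = f i" for f by (simp add: inner_axis)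
  show "(\<lambda>f. vec_lambda f \<bullet> b) \<in> borel_measurable (Pi\<^sub>M UNIV (\<lambda>_. lborel))"
    unfolding eq using measurable_component_singleton[of i UNIV "\<lambda>_. lborel :: real measure"] by simp
qed

text \<open>Lebesgue measure is characterized by the volumes of boxes, and \<open>vec_lambda\<close>
  pulls a box back to a product of intervals. Integrals over vectors thus become integrals over a
  product measure, where Fubini's theorem and \<open>grid_lines_inequality\<close> apply.\<close>

lemma lborel_vec:
  "(lborel :: (real^'n::finite) measure) = distr (Pi\<^sub>M UNIV (\<lambda>_. lborel)) borel vec_lambda"
proof (rule lborel_eqI)
  fix l u :: "real^'n" assume le: "\<And>b. b \<in> Basis \<Longrightarrow> l \<bullet> b \<le> u \<bullet> b"
  have le': "l $ i \<le> u $ i" for i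
    using le[of "axis i 1"] by (simp add: inner_axis)
  have "vec_lambda -` box l u \<inter> space (Pi\<^sub>M UNIV (\<lambda>_. lborel :: real measure)) = (\<Pi>\<^sub>E i\<in>UNIV. {l $ i <..< u $ i})"
    by (auto simp: space_PiM mem_box_cart PiE_iff)
  then have "emeasure (distr (Pi\<^sub>M UNIV (\<lambda>_. lborel)) borel vec_lambda) (box l u)
      = emeasure (Pi\<^sub>M UNIV (\<lambda>_. lborel)) (\<Pi>\<^sub>E i\<in>UNIV. {l $ i <..< u $ i})"
    by (subst emeasure_distr) auto
  also have "\<dots> = (\<Prod>i\<in>UNIV. ennreal (u $ i - l $ i))"
    using le' by (subst lborel_product.emeasure_PiM) auto
  also have "\<dots> = ennreal (\<Prod>i\<in>UNIV. u $ i - l $ i)"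
    using le' by (subst prod_ennreal) auto
  also have "(\<Prod>i\<in>UNIV. u $ i - l $ i) = (\<Prod>b\<in>range (\<lambda>i. axis i 1). (u - l) \<bullet> b)"
    by (subst prod.reindex) (auto simp: inj_on_def axis_eq_axis inner_axis)
  also have "range (\<lambda>i. axis i 1) = (Basis :: (real^'n) set)"
    by (auto simp: Basis_vec_def)
  finally show "emeasure (distr (Pi\<^sub>M UNIV (\<lambda>_. lborel)) borel vec_lambda) (box l u) = ennreal (\<Prod>b\<in>Basis. (u - l) \<bullet> b)" .
qed simp

lemma nn_integral_vec:
  fixes f :: "real^'n::finite \<Rightarrow> ennreal"
  assumes [measurable]: "f \<in> borel_measurable borel"
  shows "(\<integral>\<^sup>+x. f x \<partial>lborel) = (\<integral>\<^sup>+x. f (vec_lambda x) \<partial>Pi\<^sub>M UNIV (\<lambda>_. lborel))"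
  by (subst lborel_vec, subst nn_integral_distr) auto

lemma nn_integral_vec_slice:
  fixes f :: "real^'n::finite \<Rightarrow> ennreal"
  assumes [measurable]: "f \<in> borel_measurable borel"
  shows "(\<integral>\<^sup>+x. f x \<partial>lborel) = (\<integral>\<^sup>+z. (\<integral>\<^sup>+t. f (vec_lambda (z(i := t))) \<partial>lborel) \<partial>Pi\<^sub>M (UNIV - {i}) (\<lambda>_. lborel))"
proof -
  have [simp]: "insert i (UNIV - {i}) = UNIV" by auto
  show ?thesis
    unfolding nn_integral_vec[OF assms]
    using lborel_product.product_nn_integral_insert[of "UNIV - {i}" i "\<lambda>x. f (vec_lambda x)"] by simp
qed

text \<open>The power \<open>n / (n - 1)\<close> of \<open>F x\<close> is a product of
  \<open>n\<close> factors with exponent \<open>1 / (n - 1)\<close>, and the factor for direction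
  \<open>i\<close> is bounded through the line integral of \<open>f\<close> in that
  direction.\<close>

lemma Gagliardo_Nirenberg_slices:
  fixes f F :: "real^'n::finite \<Rightarrow> ennreal"
  assumes n: "CARD('n) \<ge> 2"
    and [measurable]: "f \<in> borel_measurable borel"
    and F: "\<And>x i. F x \<le> (\<integral>\<^sup>+t. f (vupd x i t) \<partial>lborel)"
    and [measurable]: "F \<in> borel_measurable borel"
  shows "(\<integral>\<^sup>+x. epowr (F x) (real CARD('n) / (real CARD('n) - 1)) \<partial>lborel)
         \<le> epowr (\<integral>\<^sup>+x. f x \<partial>lborel) (real CARD('n) / (real CARD('n) - 1))"
proof -
  define n where "n = real CARD('n)"
  define p where "p = 1 / (n - 1)"
  have n: "n \<ge> 2" using n by (simp add: n_def)
  then have p: "0 \<le> p" "(n - 1) * p = 1" "n / (n - 1) = 1 + p" "n * p = 1 + p"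
    by (auto simp: p_def field_simps)
  have "(\<integral>\<^sup>+x. epowr (F x) (1 + p) \<partial>lborel) = (\<integral>\<^sup>+x. epowr (F (vec_lambda x)) (1 + p) \<partial>Pi\<^sub>M UNIV (\<lambda>_. lborel))"
    by (rule nn_integral_vec) simp
  also have "\<dots> = (\<integral>\<^sup>+x. (\<Prod>i\<in>(UNIV :: 'n set). epowr (F (vec_lambda x)) p) \<partial>Pi\<^sub>M UNIV (\<lambda>_. lborel))"
    by (subst epowr_prod_const) (use p in \<open>auto simp: n_def\<close>)
  also have "\<dots> \<le> (\<integral>\<^sup>+x. epowr (f (vec_lambda x)) (1 - (n - 1) * p) * (\<Prod>i\<in>UNIV. epowr (\<integral>\<^sup>+t. f (vec_lambda (x(i := t))) \<partial>lborel) p) \<partial>Pi\<^sub>M UNIV (\<lambda>_. lborel))"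
  proof (intro nn_integral_mono)
    fix x :: "'n \<Rightarrow> real"
    have "(\<Prod>i\<in>(UNIV :: 'n set). epowr (F (vec_lambda x)) p) \<le> (\<Prod>i\<in>UNIV. epowr (\<integral>\<^sup>+t. f (vec_lambda (x(i := t))) \<partial>lborel) p)"
      using F[of "vec_lambda x", unfolded vupd_vec_lambda] p by (intro prod_mono_ennreal epowr_mono) auto
    then show "(\<Prod>i\<in>(UNIV :: 'n set). epowr (F (vec_lambda x)) p)
        \<le> epowr (f (vec_lambda x)) (1 - (n - 1) * p) * (\<Prod>i\<in>UNIV. epowr (\<integral>\<^sup>+t. f (vec_lambda (x(i := t))) \<partial>lborel) p)"
      using p by (simp del: prod_constant)
  qed
  also have "\<dots> \<le> epowr (\<integral>\<^sup>+x. f (vec_lambda x) \<partial>Pi\<^sub>M UNIV (\<lambda>_. lborel)) (1 + p)"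
    unfolding n_def using p by (intro lborel_product.grid_lines_inequality) (auto simp: n_def)
  finally show ?thesis
    using p by (simp add: nn_integral_vec n_def)
qed

text \<open>A Schur test in one coordinate: the pointwise bound is integrated over
  \<open>s = x $ i\<close>, the order of integration is exchanged, and the kernel is integrated in
  \<open>s\<close> first. The remaining coordinates are parameters.\<close>

lemma nn_integral_slice_kernel:
  fixes f F :: "real^'n::finite \<Rightarrow> ennreal" and k :: "real \<Rightarrow> real \<Rightarrow> ennreal"
  assumes [measurable]: "f \<in> borel_measurable borel" "F \<in> borel_measurable borel"
    and [measurable]: "(\<lambda>(s, t). k s t) \<in> borel_measurable borel"
    and F: "\<And>x. F x \<le> (\<integral>\<^sup>+t. k (x $ i) t * f (vupd x i t) \<partial>lborel)"
    and k: "\<And>t. (\<integral>\<^sup>+s. k s t \<partial>lborel) \<le> K"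
  shows "(\<integral>\<^sup>+x. F x \<partial>lborel) \<le> K * (\<integral>\<^sup>+x. f x \<partial>lborel)"
proof -
  have [measurable]: "(\<lambda>(s, t). k s t) \<in> borel_measurable (lborel \<Otimes>\<^sub>M lborel)"
    unfolding lborel_prod by simp
  have slice: "(\<integral>\<^sup>+s. F (vec_lambda (z(i := s))) \<partial>lborel) \<le> K * (\<integral>\<^sup>+t. f (vec_lambda (z(i := t))) \<partial>lborel)"
    if z: "z \<in> space (Pi\<^sub>M (UNIV - {i}) (\<lambda>_. lborel :: real measure))" for z
  proof -
    have [measurable]: "(\<lambda>t. vec_lambda (z(i := t))) \<in> borel_measurable lborel"
    proof -
      have "(\<lambda>t. z(i := t)) \<in> measurable lborel (Pi\<^sub>M UNIV (\<lambda>_. lborel :: real measure))"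
        using z by (intro measurable_fun_upd[where J="UNIV - {i}"]) auto
      from measurable_compose[OF this measurable_vec_lambda] show ?thesis .
    qed
    have "(\<integral>\<^sup>+s. F (vec_lambda (z(i := s))) \<partial>lborel)
        \<le> (\<integral>\<^sup>+s. \<integral>\<^sup>+t. k s t * f (vec_lambda (z(i := t))) \<partial>lborel \<partial>lborel)"
      using F[of "vec_lambda (z(i := _))"] by (intro nn_integral_mono) (simp add: vupd_vec_lambda)
    also have "\<dots> = (\<integral>\<^sup>+t. \<integral>\<^sup>+s. k s t * f (vec_lambda (z(i := t))) \<partial>lborel \<partial>lborel)"
      by (rule lborel_pair.Fubini'[symmetric]) measurable
    also have "\<dots> = (\<integral>\<^sup>+t. (\<integral>\<^sup>+s. k s t \<partial>lborel) * f (vec_lambda (z(i := t))) \<partial>lborel)"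
      by (intro nn_integral_cong nn_integral_multc) measurable
    also have "\<dots> \<le> (\<integral>\<^sup>+t. K * f (vec_lambda (z(i := t))) \<partial>lborel)"
      by (intro nn_integral_mono mult_right_mono k) auto
    also have "\<dots> = K * (\<integral>\<^sup>+t. f (vec_lambda (z(i := t))) \<partial>lborel)"
      by (rule nn_integral_cmult) measurable
    finally show ?thesis .
  qed
  have [simp]: "insert i (UNIV - {i}) = UNIV" by auto
  have [measurable]: "(\<lambda>(z, t). f (vec_lambda (z(i := t)))) \<in> borel_measurable (Pi\<^sub>M (UNIV - {i}) (\<lambda>_. lborel :: real measure) \<Otimes>\<^sub>M lborel)"
  proof -
    have "(\<lambda>w. (fst w)(i := snd w)) \<in> measurable (Pi\<^sub>M (UNIV - {i}) (\<lambda>_. lborel :: real measure) \<Otimes>\<^sub>M lborel) (Pi\<^sub>M UNIV (\<lambda>_. lborel))"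
      by (intro measurable_fun_upd[where J="UNIV - {i}"]) auto
    from measurable_compose[OF this measurable_vec_lambda] show ?thesis
      unfolding split_beta' by measurable
  qed
  have "(\<integral>\<^sup>+x. F x \<partial>lborel) \<le> (\<integral>\<^sup>+z. K * (\<integral>\<^sup>+t. f (vec_lambda (z(i := t))) \<partial>lborel) \<partial>Pi\<^sub>M (UNIV - {i}) (\<lambda>_. lborel))"
    by (subst nn_integral_vec_slice[where i=i]) (auto intro!: nn_integral_mono slice)
  also have "\<dots> = K * (\<integral>\<^sup>+x. f x \<partial>lborel)"
    by (subst nn_integral_cmult, measurable) (simp add: nn_integral_vec_slice[where i=i])
  finally show ?thesis .
qed

text \<open>The integrand concentrates near \<open>s = \<bar>t\<bar>\<close> and
  \<open>s = - \<bar>t\<bar>\<close>, where it is dominated by exponentials of rate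
  \<open>2 * c\<close>; their total mass stays bounded as \<open>t\<close> grows.\<close>

lemma nn_integral_gauss_kernel_le:
  fixes c t :: real
  assumes c: "c > 0"
  shows "(\<integral>\<^sup>+s. indicator {s. \<bar>s\<bar> \<le> \<bar>t\<bar>} s * ennreal (exp (c * (s\<^sup>2 - t\<^sup>2))) \<partial>lborel) \<le> ennreal (exp c / c)"
proof -
  define a where "a = \<bar>t\<bar>"
  \<comment> \<open>Adding the two exponentials removes the absolute value from
    \<open>exp (- 2 * c * (a - \<bar>s\<bar>))\<close>, and \<open>G\<close> is an explicit
    antiderivative of the sum.\<close>
  define g where "g s = exp c * (exp (- 2 * c * (a - s)) + exp (- 2 * c * (a + s)))" for s
  define G where "G s = exp c / (2 * c) * (exp (- 2 * c * (a - s)) - exp (- 2 * c * (a + s)))" for s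
  have a: "a \<ge> 0" by (simp add: a_def)
  have bound: "exp (c * (s\<^sup>2 - t\<^sup>2)) \<le> g s" if "\<bar>s\<bar> \<le> a" for s
  proof -
    \<comment> \<open>The right side equals
      \<open>t\<^sup>2 - s\<^sup>2 + 1 - 2 * (a - \<bar>s\<bar>)\<close>, which turns the quadratic
      exponent into a linear one.\<close>
    have "0 \<le> (a - \<bar>s\<bar> - 1)\<^sup>2 + 2 * \<bar>s\<bar> * (a - \<bar>s\<bar>)" using that by simp
    then have "s\<^sup>2 - t\<^sup>2 \<le> 1 - 2 * (a - \<bar>s\<bar>)"
      by (simp add: a_def power2_eq_square algebra_simps)
    then have "c * (s\<^sup>2 - t\<^sup>2) \<le> c * (1 - 2 * (a - \<bar>s\<bar>))"
      using c by (intro mult_left_mono) auto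
    then have "exp (c * (s\<^sup>2 - t\<^sup>2)) \<le> exp c * exp (- 2 * c * (a - \<bar>s\<bar>))"
      by (simp add: algebra_simps flip: exp_add)
    also have "\<dots> \<le> g s"
      by (cases "s \<ge> 0") (auto simp: g_def)
    finally show ?thesis .
  qed
  have "(\<integral>\<^sup>+s. indicator {s. \<bar>s\<bar> \<le> \<bar>t\<bar>} s * ennreal (exp (c * (s\<^sup>2 - t\<^sup>2))) \<partial>lborel)
      \<le> (\<integral>\<^sup>+s. ennreal (g s) * indicator {-a..a} s \<partial>lborel)"
    using bound by (intro nn_integral_mono) (auto simp: indicator_def a_def intro!: ennreal_leI)
  also have "\<dots> = ennreal (G a - G (- a))"
  proof (rule nn_integral_FTC_Icc)
    show "(G has_real_derivative g s) (at s)" for s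
      unfolding G_def g_def
      using c by (auto intro!: derivative_eq_intros simp: field_simps)
  qed (use a in \<open>auto simp: g_def\<close>)
  also have "\<dots> \<le> ennreal (exp c / c)"
  proof (rule ennreal_leI)
    have "G a - G (- a) = exp c / c * (1 - exp (- 4 * c * a))"
      using c by (simp add: G_def field_simps)
    also have "\<dots> \<le> exp c / c"
      using c by (simp add: field_simps)
    finally show "G a - G (- a) \<le> exp c / c" .
  qed
  finally show ?thesis .
qed

section \<open>The weighted Gagliardo-Nirenberg and Poincare inequalities\<close>

lemma increment_le_nn_integral:
  fixes g g' B :: "real \<Rightarrow> real"
  assumes "a \<le> b" and g: "\<And>t. (g has_real_derivative g' t) (at t)"
    and B: "\<And>t. \<bar>g' t\<bar> \<le> B t" "continuous_on UNIV B"
  shows "ennreal \<bar>g b - g a\<bar> \<le> (\<integral>\<^sup>+t. ennreal (B t) * indicator {a..b} t \<partial>lborel)"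
proof -
  \<comment> \<open>The gauge integral gives the fundamental theorem for the bare derivative
    \<open>g'\<close>; only the continuous majorant \<open>B\<close> is converted into a Lebesgue
    integral.\<close>
  have int: "(g' has_integral (g b - g a)) {a..b}"
    using assms(1) g
    by (intro fundamental_theorem_of_calculus)
      (auto simp: has_real_derivative_iff_has_vector_derivative[symmetric] intro: has_field_derivative_at_within)
  have B_int: "B integrable_on {a..b}"
    using B(2) by (intro integrable_continuous_real continuous_on_subset[OF B(2)]) auto
  have "norm (integral {a..b} g') \<le> integral {a..b} B"
    using int B_int B(1) by (intro integral_norm_bound_integral) (auto simp: integrable_on_def)
  then have "\<bar>g b - g a\<bar> \<le> integral {a..b} B"
    using int by (simp add: integral_unique)
  then have "ennreal \<bar>g b - g a\<bar> \<le> ennreal (integral {a..b} B)"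
    by (rule ennreal_leI)
  also have "\<dots> = (\<integral>\<^sup>+t. ennreal (B t) * indicator {a..b} t \<partial>lborel)"
    using B(1) B_int
    by (intro nn_integral_has_integral_lebesgue'[symmetric] integrable_integral)
      (auto intro: order_trans[OF abs_ge_zero])
  finally show ?thesis .
qed

text \<open>Integration starts at \<open>s\<close> and runs away from the origin to a point where
  \<open>g\<close> vanishes, to the right for \<open>s \<ge> 0\<close> and to the left otherwise.
  Only \<open>\<bar>t\<bar> \<ge> \<bar>s\<bar>\<close> is visited, where a weight increasing in
  \<open>\<bar>t\<bar>\<close> is at least its value at \<open>s\<close>.\<close>

lemma abs_le_nn_integral_outer:
  fixes g g' B :: "real \<Rightarrow> real"
  assumes g: "\<And>t. (g has_real_derivative g' t) (at t)"
    and B: "\<And>t. \<bar>g' t\<bar> \<le> B t" "continuous_on UNIV B"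
    and R: "\<And>t. R \<le> \<bar>t\<bar> \<Longrightarrow> g t = 0"
  shows "ennreal \<bar>g s\<bar> \<le> (\<integral>\<^sup>+t. indicator {t. \<bar>s\<bar> \<le> \<bar>t\<bar>} t * ennreal (B t) \<partial>lborel)"
proof -
  \<comment> \<open>Large enough that \<open>g\<close> vanishes at \<open>b\<close> and
    \<open>- b\<close> and that \<open>s\<close> lies between them.\<close>
  define b where "b = \<bar>R\<bar> + \<bar>s\<bar>"
  have b: "g b = 0" "g (- b) = 0" "s \<le> b" "- b \<le> s"
    using R by (auto simp: b_def)
  show ?thesis
  proof (cases "s \<ge> 0")
    case True
    have "ennreal \<bar>g s\<bar> = ennreal \<bar>g b - g s\<bar>" using b by simp
    also have "\<dots> \<le> (\<integral>\<^sup>+t. ennreal (B t) * indicator {s..b} t \<partial>lborel)"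
      by (rule increment_le_nn_integral[OF b(3) g B])
    also have "\<dots> \<le> (\<integral>\<^sup>+t. indicator {t. \<bar>s\<bar> \<le> \<bar>t\<bar>} t * ennreal (B t) \<partial>lborel)"
      using True by (intro nn_integral_mono) (auto simp: indicator_def)
    finally show ?thesis .
  next
    case False
    have "ennreal \<bar>g s\<bar> = ennreal \<bar>g s - g (- b)\<bar>" using b by simp
    also have "\<dots> \<le> (\<integral>\<^sup>+t. ennreal (B t) * indicator {- b..s} t \<partial>lborel)"
      by (rule increment_le_nn_integral[OF b(4) g B])
    also have "\<dots> \<le> (\<integral>\<^sup>+t. indicator {t. \<bar>s\<bar> \<le> \<bar>t\<bar>} t * ennreal (B t) \<partial>lborel)"
      using False by (intro nn_integral_mono) (auto simp: indicator_def)
    finally show ?thesis .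
  qed
qed

text \<open>Away from 0 this is the power rule on a half-line. At 0 the difference quotient has
  absolute value \<open>\<bar>h\<bar> powr (\<gamma> - 1)\<close>, which tends to 0 because
  \<open>\<gamma> > 1\<close>.\<close>

lemma has_real_derivative_abs_powr:
  fixes y \<gamma> :: real
  assumes \<gamma>: "\<gamma> > 1"
  shows "((\<lambda>y. \<bar>y\<bar> powr \<gamma>) has_real_derivative (\<gamma> * \<bar>y\<bar> powr (\<gamma> - 1) * sgn y)) (at y)"
proof -
  consider "y > 0" | "y < 0" | "y = 0" by linarith
  then show ?thesis
  proof cases
    case 1
    have "((\<lambda>y. y powr \<gamma>) has_real_derivative (\<gamma> * \<bar>y\<bar> powr (\<gamma> - 1) * sgn y)) (at y)"
      using 1 by (auto intro!: derivative_eq_intros)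
    moreover have "\<forall>\<^sub>F z in nhds y. z powr \<gamma> = \<bar>z\<bar> powr \<gamma>"
      using eventually_nhds_in_open[of "{0<..}" y] 1 by (auto elim!: eventually_mono)
    ultimately show ?thesis by (subst (asm) DERIV_cong_ev) auto
  next
    case 2
    have "((\<lambda>y. (- y) powr \<gamma>) has_real_derivative (\<gamma> * \<bar>y\<bar> powr (\<gamma> - 1) * sgn y)) (at y)"
      using 2 by (auto intro!: derivative_eq_intros)
    moreover have "\<forall>\<^sub>F z in nhds y. (- z) powr \<gamma> = \<bar>z\<bar> powr \<gamma>"
      using eventually_nhds_in_open[of "{..<0}" y] 2 by (auto elim!: eventually_mono)
    ultimately show ?thesis by (subst (asm) DERIV_cong_ev) auto
  next
    case 3
    have "((\<lambda>h. \<bar>h\<bar> powr (\<gamma> - 1)) \<longlongrightarrow> \<bar>0\<bar> powr (\<gamma> - 1)) (at (0::real))"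
      using \<gamma> by (intro tendsto_powr' tendsto_intros) auto
    then have "((\<lambda>h. \<bar>h\<bar> powr (\<gamma> - 1)) \<longlongrightarrow> 0) (at (0::real))" by simp
    then have "((\<lambda>h. norm ((\<bar>0 + h\<bar> powr \<gamma> - \<bar>0\<bar> powr \<gamma>) / h)) \<longlongrightarrow> 0) (at (0::real))"
      by (rule Lim_transform_eventually)
        (auto simp: eventually_at_filter powr_diff abs_divide)
    then have "((\<lambda>h. (\<bar>0 + h\<bar> powr \<gamma> - \<bar>0\<bar> powr \<gamma>) / h) \<longlongrightarrow> 0) (at (0::real))"
      by (rule tendsto_norm_zero_cancel)
    then show ?thesis
      using 3 by (simp add: DERIV_def)
  qed
qed

section \<open>Derivatives and support of test functions\<close>

lemma Ccinf_differentiable: "u \<in> Ccinf \<Longrightarrow> foldr pdiff is u differentiable (at x)"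
  by (simp add: Ccinf_def smooth_def)

text \<open>The entries of \<open>grad u x\<close> are the values of the Frechet derivative on the
  axis vectors, and linearity recovers the whole derivative from them.\<close>

lemma Ccinf_has_derivative:
  assumes "u \<in> Ccinf"
  shows "(u has_derivative (\<lambda>h. grad u x \<bullet> h)) (at x)"
proof -
  have "u differentiable (at x)"
    using Ccinf_differentiable[OF assms, of "[]"] by simp
  then have D: "(u has_derivative frechet_derivative u (at x)) (at x)"
    by (simp add: frechet_derivative_works)
  let ?D = "frechet_derivative u (at x)"
  have "?D h = grad u x \<bullet> h" for h
  proof -
    have "h = (\<Sum>i\<in>UNIV. h $ i *\<^sub>R axis i 1)"
      using basis_expansion[of h] by (simp add: scalar_mult_eq_scaleR)
    then have "?D h = ?D (\<Sum>i\<in>UNIV. h $ i *\<^sub>R axis i 1)" by simp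
    also have "\<dots> = (\<Sum>i\<in>UNIV. h $ i * ?D (axis i 1))"
      using has_derivative_linear[OF D] by (simp add: linear_sum linear_cmul)
    finally show ?thesis
      by (simp add: grad_def pdiff_def inner_vec_def mult.commute)
  qed
  then have "?D = (\<lambda>h. grad u x \<bullet> h)" by auto
  with D show ?thesis by simp
qed

lemma Ccinf_continuous: "u \<in> Ccinf \<Longrightarrow> continuous_on UNIV u"
  by (intro continuous_at_imp_continuous_on ballI has_derivative_continuous[OF Ccinf_has_derivative])

lemma Ccinf_continuous_grad:
  assumes "u \<in> Ccinf"
  shows "continuous_on UNIV (grad u)"
proof -
  have "pdiff i u differentiable (at x)" for i x
    using Ccinf_differentiable[OF assms, of "[i]"] by simp
  then have "continuous_on UNIV (pdiff i u)" for i
    by (intro continuous_at_imp_continuous_on ballI differentiable_imp_continuous_within)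
  then show ?thesis
    unfolding grad_def[abs_def] by (intro continuous_on_vec_lambda)
qed

lemma Ccinf_measurable [measurable]:
  assumes "u \<in> Ccinf"
  shows "u \<in> borel_measurable borel" "grad u \<in> borel_measurable borel"
  using Ccinf_continuous[OF assms] Ccinf_continuous_grad[OF assms]
  by (auto intro: borel_measurable_continuous_onI)

lemma Ccinf_support:
  assumes "u \<in> Ccinf"
  shows "\<exists>R. \<forall>x. R \<le> norm x \<longrightarrow> u x = 0 \<and> grad u x = 0"
proof -
  have "bounded (closure {x. u x \<noteq> 0})"
    using assms by (auto simp: Ccinf_def compact_imp_bounded)
  then obtain R where "\<forall>x\<in>closure {x. u x \<noteq> 0}. norm x \<le> R"
    unfolding bounded_iff by (rule exE)
  then have R: "norm x \<le> R" if "u x \<noteq> 0" for x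
    using that closure_subset[of "{x. u x \<noteq> 0}"] by auto
  \<comment> \<open>The margin 1 puts \<open>x\<close> into the open complement of the ball of
    radius \<open>R\<close>, on which \<open>u\<close> vanishes identically, so that its derivative
    vanishes as well.\<close>
  have "u x = 0" "grad u x = 0" if "R + 1 \<le> norm x" for x
  proof -
    show "u x = 0" using R[of x] that by (cases "u x = 0") auto
    have "(u has_derivative (\<lambda>h. 0)) (at x)"
    proof (rule has_derivative_transform_within_open)
      show "open (- cball 0 R)" by (auto intro: open_Compl)
      show "x \<in> - cball 0 R" using that by (auto simp: dist_norm)
      show "0 = u y" if "y \<in> - cball 0 R" for y
        using R[of y] that by (auto simp: dist_norm)
    qed (rule has_derivative_const)
    then have "(\<lambda>h. grad u x \<bullet> h) = (\<lambda>h. 0)"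
      by (rule has_derivative_unique[OF Ccinf_has_derivative[OF assms]])
    then show "grad u x = 0"
      by (subst inner_eq_zero_iff[symmetric]) (rule fun_cong)
  qed
  then show ?thesis by blast
qed

lemma Ccinf_line_derivative:
  assumes "u \<in> Ccinf"
  shows "((\<lambda>t. u (x + t *\<^sub>R h)) has_real_derivative (grad u (x + t *\<^sub>R h) \<bullet> h)) (at t)"
proof -
  have "((\<lambda>t. u (x + t *\<^sub>R h)) has_derivative (\<lambda>s. grad u (x + t *\<^sub>R h) \<bullet> (s *\<^sub>R h))) (at t)"
    by (rule has_derivative_compose[OF _ Ccinf_has_derivative[OF assms], of "\<lambda>t. x + t *\<^sub>R h"])
      (auto intro!: derivative_eq_intros)
  then show ?thesis
    by (simp add: has_field_derivative_def mult.commute[of _ "_ \<bullet> _"] mult_commute_abs)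
qed

text \<open>For \<open>\<gamma> > 1\<close> this is the norm of the gradient of
  \<open>\<bar>u\<bar> powr \<gamma>\<close>. For \<open>\<gamma> = 1\<close> it is
  \<open>norm (grad u x)\<close> also at the zeros of \<open>u\<close>, where the absolute value may
  fail to be differentiable.\<close>

definition grad_abs_powr :: "real \<Rightarrow> (real^'n::finite \<Rightarrow> real) \<Rightarrow> real^'n \<Rightarrow> ennreal" where
  "grad_abs_powr \<gamma> u x = ennreal \<gamma> * epowr (ennreal \<bar>u x\<bar>) (\<gamma> - 1) * ennreal (norm (grad u x))"

lemma measurable_grad_abs_powr:
  "u \<in> Ccinf \<Longrightarrow> grad_abs_powr \<gamma> u \<in> borel_measurable borel"
  using Ccinf_measurable[of u] unfolding grad_abs_powr_def[abs_def] by measurable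

lemma abs_powr_le_slice:
  assumes u: "u \<in> Ccinf" and \<gamma>: "\<gamma> \<ge> 1"
  shows "ennreal (\<bar>u x\<bar> powr \<gamma>) \<le>
    (\<integral>\<^sup>+t. indicator {t. \<bar>x $ i\<bar> \<le> \<bar>t\<bar>} t * grad_abs_powr \<gamma> u (vupd x i t) \<partial>lborel)"
proof -
  obtain R where R: "\<forall>x. R \<le> norm x \<longrightarrow> u x = 0 \<and> grad u x = 0"
    using Ccinf_support[OF u] by (rule exE)
  let ?y = "\<lambda>t. vupd x i t"
  have v: "((\<lambda>t. u (?y t)) has_real_derivative grad u (?y t) $ i) (at t)" for t
    using Ccinf_line_derivative[OF u, of "x - (x $ i) *\<^sub>R axis i 1" "axis i 1" t]
    by (simp add: vupd_eq_line inner_axis)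
  have y: "continuous_on UNIV ?y"
    unfolding vupd_eq_line by (intro continuous_intros)
  have cont: "continuous_on UNIV (\<lambda>t. u (?y t))" "continuous_on UNIV (\<lambda>t. grad u (?y t))"
    by (rule continuous_on_compose2[OF _ y subset_UNIV], rule Ccinf_continuous Ccinf_continuous_grad, rule u)+
  have R': "u (?y t) = 0" if "R \<le> \<bar>t\<bar>" for t
    using R[THEN spec, of "?y t"] abs_le_norm_vupd[of t x i] that by simp
  have le: "\<bar>grad u z $ i\<bar> \<le> norm (grad u z)" for z
    by (rule component_le_norm_cart)
  show ?thesis
  \<comment> \<open>Since \<open>\<bar>y\<bar>\<close> is not differentiable at 0, the case
    \<open>\<gamma> = 1\<close> integrates the derivative of \<open>u\<close> itself; for larger
    \<open>\<gamma>\<close> the chain rule applies to the power.\<close>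
  proof (cases "\<gamma> = 1")
    case True
    have "ennreal \<bar>u (?y (x $ i))\<bar> \<le> (\<integral>\<^sup>+t. indicator {t. \<bar>x $ i\<bar> \<le> \<bar>t\<bar>} t * ennreal (norm (grad u (?y t))) \<partial>lborel)"
      using v R' le cont by (intro abs_le_nn_integral_outer[where R=R]) (auto intro!: continuous_intros)
    then show ?thesis using True by (simp add: grad_abs_powr_def)
  next
    case False
    with \<gamma> have \<gamma>: "\<gamma> > 1" by simp
    have "ennreal \<bar>\<bar>u (?y (x $ i))\<bar> powr \<gamma>\<bar> \<le>
        (\<integral>\<^sup>+t. indicator {t. \<bar>x $ i\<bar> \<le> \<bar>t\<bar>} t * ennreal (\<gamma> * \<bar>u (?y t)\<bar> powr (\<gamma> - 1) * norm (grad u (?y t))) \<partial>lborel)"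
    proof (rule abs_le_nn_integral_outer[where R=R])
      show "((\<lambda>t. \<bar>u (?y t)\<bar> powr \<gamma>) has_real_derivative
          (\<gamma> * \<bar>u (?y t)\<bar> powr (\<gamma> - 1) * sgn (u (?y t)) * grad u (?y t) $ i)) (at t)" for t
        by (rule DERIV_chain2[OF has_real_derivative_abs_powr[OF \<gamma>] v])
      show "\<bar>\<gamma> * \<bar>u (?y t)\<bar> powr (\<gamma> - 1) * sgn (u (?y t)) * grad u (?y t) $ i\<bar>
          \<le> \<gamma> * \<bar>u (?y t)\<bar> powr (\<gamma> - 1) * norm (grad u (?y t))" for t
        using le[of "?y t"] \<gamma> by (auto simp: abs_mult abs_sgn_eq intro!: mult_left_mono)
      show "continuous_on UNIV (\<lambda>t. \<gamma> * \<bar>u (?y t)\<bar> powr (\<gamma> - 1) * norm (grad u (?y t)))"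
        using \<gamma> cont by (intro continuous_intros continuous_on_powr') auto
    qed (use R' \<gamma> in auto)
    then show ?thesis
      using \<gamma> by (simp add: grad_abs_powr_def epowr_ennreal ennreal_mult)
  qed
qed

lemma nn_integral_gauss_measure:
  fixes f :: "real^'n::finite \<Rightarrow> ennreal"
  assumes [measurable]: "f \<in> borel_measurable borel"
  shows "(\<integral>\<^sup>+x. f x \<partial>gauss_measure c) = (\<integral>\<^sup>+x. ennreal (exp (c * (norm x)\<^sup>2)) * f x \<partial>lborel)"
  unfolding gauss_measure_def by (rule nn_integral_density) auto

lemma gauss_weighted_Gagliardo_Nirenberg:
  fixes u :: "real^'n::finite \<Rightarrow> real"
  assumes n2: "CARD('n) \<ge> 2" and c: "c > 0" and u: "u \<in> Ccinf" and \<gamma>: "\<gamma> \<ge> 1"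
  defines "r \<equiv> real CARD('n) / (real CARD('n) - 1)"
  shows "(\<integral>\<^sup>+x. ennreal (\<bar>u x\<bar> powr (\<gamma> * r)) \<partial>gauss_measure c)
      \<le> epowr (\<integral>\<^sup>+x. grad_abs_powr \<gamma> u x \<partial>gauss_measure c) r"
proof -
  note [measurable] = Ccinf_measurable[OF u] measurable_grad_abs_powr[OF u]
  define w where "w = (\<lambda>x::real^'n. ennreal (exp (c * (norm x)\<^sup>2)))"
  have [measurable]: "w \<in> borel_measurable borel" unfolding w_def by measurable
  have r: "r \<ge> 1" using n2 by (simp add: r_def field_simps)
  have "(\<integral>\<^sup>+x. ennreal (\<bar>u x\<bar> powr (\<gamma> * r)) \<partial>gauss_measure c)
      = (\<integral>\<^sup>+x. w x * ennreal (\<bar>u x\<bar> powr (\<gamma> * r)) \<partial>lborel)"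
    unfolding w_def by (rule nn_integral_gauss_measure) measurable
  \<comment> \<open>The slice inequality raises the weight to the power \<open>r\<close> as well.
    Since \<open>w \<ge> 1\<close> and \<open>r \<ge> 1\<close>, this only enlarges the
    integrand.\<close>
  also have "\<dots> \<le> (\<integral>\<^sup>+x. epowr (w x * ennreal (\<bar>u x\<bar> powr \<gamma>)) r \<partial>lborel)"
  proof (rule nn_integral_mono)
    fix x :: "real^'n"
    have "exp (c * (norm x)\<^sup>2) powr 1 \<le> exp (c * (norm x)\<^sup>2) powr r"
      using r c by (intro powr_mono) auto
    then have "w x \<le> epowr (w x) r"
      using r by (auto simp: w_def epowr_ennreal intro!: ennreal_leI)
    then show "w x * ennreal (\<bar>u x\<bar> powr (\<gamma> * r)) \<le> epowr (w x * ennreal (\<bar>u x\<bar> powr \<gamma>)) r"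
      using r by (auto simp: epowr_mult epowr_ennreal powr_powr intro!: mult_right_mono)
  qed
  also have "\<dots> \<le> epowr (\<integral>\<^sup>+x. w x * grad_abs_powr \<gamma> u x \<partial>lborel) r"
    unfolding r_def
  proof (rule Gagliardo_Nirenberg_slices[OF n2])
    fix x :: "real^'n" and i
    have [measurable]: "(\<lambda>t. vupd x i t) \<in> borel_measurable borel"
      unfolding vupd_eq_line by measurable
    have "w x * ennreal (\<bar>u x\<bar> powr \<gamma>)
        \<le> w x * (\<integral>\<^sup>+t. indicator {t. \<bar>x $ i\<bar> \<le> \<bar>t\<bar>} t * grad_abs_powr \<gamma> u (vupd x i t) \<partial>lborel)"
      by (intro mult_left_mono abs_powr_le_slice u \<gamma>) auto
    also have "\<dots> = (\<integral>\<^sup>+t. w x * (indicator {t. \<bar>x $ i\<bar> \<le> \<bar>t\<bar>} t * grad_abs_powr \<gamma> u (vupd x i t)) \<partial>lborel)"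
      by (rule nn_integral_cmult[symmetric]) measurable
    also have "\<dots> \<le> (\<integral>\<^sup>+t. w (vupd x i t) * grad_abs_powr \<gamma> u (vupd x i t) \<partial>lborel)"
    proof (intro nn_integral_mono)
      fix t
      show "w x * (indicator {t. \<bar>x $ i\<bar> \<le> \<bar>t\<bar>} t * grad_abs_powr \<gamma> u (vupd x i t))
          \<le> w (vupd x i t) * grad_abs_powr \<gamma> u (vupd x i t)"
      proof (cases "\<bar>x $ i\<bar> \<le> \<bar>t\<bar>")
        case True
        then have "(x $ i)\<^sup>2 \<le> t\<^sup>2" by (simp add: abs_le_square_iff)
        then have "w x \<le> w (vupd x i t)"
          using c unfolding w_def norm_vupd_power2[of x i t] by (intro ennreal_leI) simp
        then show ?thesis using True by (auto intro!: mult_right_mono)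
      qed simp
    qed
    finally show "w x * ennreal (\<bar>u x\<bar> powr \<gamma>) \<le> (\<integral>\<^sup>+t. w (vupd x i t) * grad_abs_powr \<gamma> u (vupd x i t) \<partial>lborel)" .
  qed measurable
  also have "(\<integral>\<^sup>+x. w x * grad_abs_powr \<gamma> u x \<partial>lborel) = (\<integral>\<^sup>+x. grad_abs_powr \<gamma> u x \<partial>gauss_measure c)"
    unfolding w_def by (rule nn_integral_gauss_measure[symmetric]) measurable
  finally show ?thesis .
qed

text \<open>The quotient of the weights at \<open>x\<close> and at \<open>vupd x i t\<close> depends
  only on \<open>x $ i\<close> and \<open>t\<close>. Restricted to
  \<open>\<bar>x $ i\<bar> \<le> \<bar>t\<bar>\<close> it is the kernel \<open>k\<close>, whose
  integral in the first variable is bounded, so the Schur test applies.\<close>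

lemma gauss_weighted_Poincare:
  fixes u :: "real^'n::finite \<Rightarrow> real"
  assumes c: "c > 0" and u: "u \<in> Ccinf" and \<gamma>: "\<gamma> \<ge> 1"
  shows "(\<integral>\<^sup>+x. ennreal (\<bar>u x\<bar> powr \<gamma>) \<partial>gauss_measure c)
      \<le> ennreal (exp c / c) * (\<integral>\<^sup>+x. grad_abs_powr \<gamma> u x \<partial>gauss_measure c)"
proof -
  note [measurable] = Ccinf_measurable[OF u] measurable_grad_abs_powr[OF u]
  define w where "w = (\<lambda>x::real^'n. ennreal (exp (c * (norm x)\<^sup>2)))"
  have [measurable]: "w \<in> borel_measurable borel" unfolding w_def by measurable
  define k where "k s t = indicator {s. \<bar>s\<bar> \<le> \<bar>t\<bar>} s * ennreal (exp (c * (s\<^sup>2 - t\<^sup>2)))" for s t :: real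
  have "(\<integral>\<^sup>+x. ennreal (\<bar>u x\<bar> powr \<gamma>) \<partial>gauss_measure c) = (\<integral>\<^sup>+x. w x * ennreal (\<bar>u x\<bar> powr \<gamma>) \<partial>lborel)"
    unfolding w_def by (rule nn_integral_gauss_measure) measurable
  also have "\<dots> \<le> ennreal (exp c / c) * (\<integral>\<^sup>+x. w x * grad_abs_powr \<gamma> u x \<partial>lborel)"
  \<comment> \<open>One coordinate direction is enough, and any will do.\<close>
  proof (rule nn_integral_slice_kernel[where k = k and i = "SOME i. True"])
    have "k s t = indicator {st. \<bar>fst st\<bar> \<le> \<bar>snd st\<bar>} (s, t) * ennreal (exp (c * ((fst (s, t))\<^sup>2 - (snd (s, t))\<^sup>2)))" for s t
      by (auto simp: k_def indicator_def)
    then have eq: "(\<lambda>(s, t). k s t) = (\<lambda>st. indicator {st. \<bar>fst st\<bar> \<le> \<bar>snd st\<bar>} st * ennreal (exp (c * ((fst st)\<^sup>2 - (snd st)\<^sup>2))))"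
      by auto
    have "closed {st :: real \<times> real. \<bar>fst st\<bar> \<le> \<bar>snd st\<bar>}"
      by (intro closed_Collect_le continuous_intros)
    then have [measurable]: "{st :: real \<times> real. \<bar>fst st\<bar> \<le> \<bar>snd st\<bar>} \<in> sets borel" by simp
    have [measurable]: "(\<lambda>st :: real \<times> real. c * ((fst st)\<^sup>2 - (snd st)\<^sup>2)) \<in> borel_measurable borel"
      by (intro borel_measurable_continuous_onI continuous_intros)
    show "(\<lambda>(s, t). k s t) \<in> borel_measurable borel"
      unfolding eq by measurable
    show "(\<integral>\<^sup>+s. k s t \<partial>lborel) \<le> ennreal (exp c / c)" for t
      unfolding k_def by (rule nn_integral_gauss_kernel_le[OF c])
  next
    fix x :: "real^'n"
    let ?i = "SOME i. True"
    have [measurable]: "(\<lambda>t. vupd x ?i t) \<in> borel_measurable borel"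
      unfolding vupd_eq_line by measurable
    have "w x * ennreal (\<bar>u x\<bar> powr \<gamma>)
        \<le> w x * (\<integral>\<^sup>+t. indicator {t. \<bar>x $ ?i\<bar> \<le> \<bar>t\<bar>} t * grad_abs_powr \<gamma> u (vupd x ?i t) \<partial>lborel)"
      by (intro mult_left_mono abs_powr_le_slice u \<gamma>) auto
    also have "\<dots> = (\<integral>\<^sup>+t. w x * (indicator {t. \<bar>x $ ?i\<bar> \<le> \<bar>t\<bar>} t * grad_abs_powr \<gamma> u (vupd x ?i t)) \<partial>lborel)"
      by (rule nn_integral_cmult[symmetric]) measurable
    also have "\<dots> = (\<integral>\<^sup>+t. k (x $ ?i) t * (w (vupd x ?i t) * grad_abs_powr \<gamma> u (vupd x ?i t)) \<partial>lborel)"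
    proof (intro nn_integral_cong)
      fix t
      have "w x = ennreal (exp (c * ((x $ ?i)\<^sup>2 - t\<^sup>2))) * w (vupd x ?i t)"
        unfolding w_def norm_vupd_power2[of x ?i t]
        by (simp flip: ennreal_mult exp_add add: algebra_simps)
      then show "w x * (indicator {t. \<bar>x $ ?i\<bar> \<le> \<bar>t\<bar>} t * grad_abs_powr \<gamma> u (vupd x ?i t))
          = k (x $ ?i) t * (w (vupd x ?i t) * grad_abs_powr \<gamma> u (vupd x ?i t))"
        by (simp add: k_def indicator_def mult.assoc)
    qed
    finally show "w x * ennreal (\<bar>u x\<bar> powr \<gamma>)
        \<le> (\<integral>\<^sup>+t. k (x $ ?i) t * (w (vupd x ?i t) * grad_abs_powr \<gamma> u (vupd x ?i t)) \<partial>lborel)" .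
  qed measurable
  also have "(\<integral>\<^sup>+x. w x * grad_abs_powr \<gamma> u x \<partial>lborel) = (\<integral>\<^sup>+x. grad_abs_powr \<gamma> u x \<partial>gauss_measure c)"
    unfolding w_def by (rule nn_integral_gauss_measure[symmetric]) measurable
  finally show ?thesis .
qed

section \<open>Sobolev exponents\<close>

lemma integrable_gauss_measure:
  fixes g :: "real^'n::finite \<Rightarrow> real"
  assumes g: "continuous_on UNIV g" and R: "\<And>x. R \<le> norm x \<Longrightarrow> g x = 0"
  shows "integrable (gauss_measure c) g"
proof -
  have [measurable]: "g \<in> borel_measurable borel"
    using g by (rule borel_measurable_continuous_onI)
  have "integrable lborel (\<lambda>x. indicator (cball 0 R) x *\<^sub>R (exp (c * (norm x)\<^sup>2) *\<^sub>R g x))"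
    by (intro borel_integrable_compact compact_cball continuous_intros continuous_on_subset[OF g]) auto
  also have "(\<lambda>x. indicator (cball 0 R) x *\<^sub>R (exp (c * (norm x)\<^sup>2) *\<^sub>R g x)) = (\<lambda>x. exp (c * (norm x)\<^sup>2) *\<^sub>R g x)"
    using R by (auto simp: fun_eq_iff indicator_def)
  finally show ?thesis
    unfolding gauss_measure_def by (subst integrable_density) auto
qed

lemma sets_gauss_measure [measurable_cong, simp]: "sets (gauss_measure c) = sets borel"
  by (simp add: gauss_measure_def)

text \<open>Finiteness matters twice: the Bochner integral of a non-integrable function would be 0
  by convention, and later a power of an integral is cancelled from both sides of an
  inequality.\<close>

lemma Ccinf_integrable_powr:
  assumes u: "u \<in> Ccinf" and a: "a > 0"
  shows "integrable (gauss_measure c) (\<lambda>x. \<bar>u x\<bar> powr a)"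
    and "integrable (gauss_measure c) (\<lambda>x. norm (grad u x) powr a)"
proof -
  obtain R where R: "\<forall>x. R \<le> norm x \<longrightarrow> u x = 0 \<and> grad u x = 0"
    using Ccinf_support[OF u] by (rule exE)
  show "integrable (gauss_measure c) (\<lambda>x. \<bar>u x\<bar> powr a)"
    using R a Ccinf_continuous[OF u]
    by (intro integrable_gauss_measure[where R=R] continuous_on_powr' continuous_intros) auto
  show "integrable (gauss_measure c) (\<lambda>x. norm (grad u x) powr a)"
    using R a Ccinf_continuous_grad[OF u]
    by (intro integrable_gauss_measure[where R=R] continuous_on_powr' continuous_intros) auto
qed

lemma Ccinf_nn_integral_powr:
  assumes u: "u \<in> Ccinf" and a: "a > 0"
  shows "(\<integral>\<^sup>+x. ennreal (\<bar>u x\<bar> powr a) \<partial>gauss_measure c) = ennreal (\<integral>x. \<bar>u x\<bar> powr a \<partial>gauss_measure c)"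
    and "(\<integral>\<^sup>+x. ennreal (norm (grad u x) powr a) \<partial>gauss_measure c) = ennreal (\<integral>x. norm (grad u x) powr a \<partial>gauss_measure c)"
  using Ccinf_integrable_powr[OF u a] by (intro nn_integral_eq_integral; simp)+

lemma Lp_norm_nonneg: "Lp_norm M p g \<ge> 0"
  by (simp add: Lp_norm_def)

lemma Lp_norm_powr: "p > 0 \<Longrightarrow> Lp_norm M p g powr p = (\<integral>x. \<bar>g x\<bar> powr p \<partial>M)"
  by (simp add: Lp_norm_def powr_powr)

text \<open>Hoelder's inequality with exponents \<open>p / (p - 1)\<close> and \<open>p\<close>
  separates \<open>\<bar>u\<bar> powr (\<gamma> - 1)\<close> from the gradient, which produces the
  exponent \<open>(\<gamma> - 1) * p / (p - 1)\<close> of \<open>u\<close>.\<close>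

lemma nn_integral_grad_abs_powr_le:
  assumes u: "u \<in> Ccinf" and p: "p > 1" and \<gamma>: "\<gamma> > 1"
  shows "(\<integral>\<^sup>+x. grad_abs_powr \<gamma> u x \<partial>gauss_measure c)
    \<le> ennreal (\<gamma> * (\<integral>x. \<bar>u x\<bar> powr ((\<gamma> - 1) * p / (p - 1)) \<partial>gauss_measure c) powr ((p - 1) / p)
        * Lp_norm (gauss_measure c) p (\<lambda>x. norm (grad u x)))"
proof -
  note [measurable] = Ccinf_measurable[OF u] measurable_grad_abs_powr[OF u]
  let ?M = "gauss_measure c"
  define a where "a = (\<gamma> - 1) * p / (p - 1)"
  have a: "a > 0" "a * ((p - 1) / p) = \<gamma> - 1" using p \<gamma> by (auto simp: a_def)
  have "grad_abs_powr \<gamma> u x = ennreal \<gamma> *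
      (epowr (ennreal (\<bar>u x\<bar> powr a)) ((p - 1) / p) * epowr (ennreal (norm (grad u x) powr p)) (1 / p))" for x
    using p \<gamma> a by (simp add: grad_abs_powr_def epowr_ennreal powr_powr mult.assoc)
  then have "(\<integral>\<^sup>+x. grad_abs_powr \<gamma> u x \<partial>?M) = (\<integral>\<^sup>+x. ennreal \<gamma> *
      (epowr (ennreal (\<bar>u x\<bar> powr a)) ((p - 1) / p) * epowr (ennreal (norm (grad u x) powr p)) (1 / p)) \<partial>?M)"
    by simp
  also have "\<dots> = ennreal \<gamma> * (\<integral>\<^sup>+x.
      epowr (ennreal (\<bar>u x\<bar> powr a)) ((p - 1) / p) * epowr (ennreal (norm (grad u x) powr p)) (1 / p) \<partial>?M)"
    by (rule nn_integral_cmult) measurable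
  also have "\<dots> \<le> ennreal \<gamma> * (epowr (\<integral>\<^sup>+x. ennreal (\<bar>u x\<bar> powr a) \<partial>?M) ((p - 1) / p)
      * epowr (\<integral>\<^sup>+x. ennreal (norm (grad u x) powr p) \<partial>?M) (1 / p))"
    using p by (intro mult_left_mono Holder_nn_integral) (auto simp: field_simps)
  also have "\<dots> = ennreal (\<gamma> * ((\<integral>x. \<bar>u x\<bar> powr a \<partial>?M) powr ((p - 1) / p) * (\<integral>x. norm (grad u x) powr p \<partial>?M) powr (1 / p)))"
    using p \<gamma> a u
    by (simp add: Ccinf_nn_integral_powr epowr_ennreal ennreal_mult)
  finally show ?thesis
    by (simp add: a_def Lp_norm_def mult.assoc)
qed

lemma nn_integral_grad_abs_powr_1:
  assumes u: "u \<in> Ccinf"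
  shows "(\<integral>\<^sup>+x. grad_abs_powr 1 u x \<partial>gauss_measure c)
    = ennreal (Lp_norm (gauss_measure c) 1 (\<lambda>x. norm (grad u x)))"
  using Ccinf_nn_integral_powr(2)[OF u, of 1 c] by (simp add: grad_abs_powr_def Lp_norm_def)

section \<open>Control by the gradient norm, and interpolation\<close>

text \<open>This is the embedding inequality raised to the power \<open>q\<close>: without roots,
  such bounds can be added and iterated as bounds on integrals. The root is taken in
  \<open>grad_controls_Lp_norm\<close>.\<close>

definition grad_controls :: "(real^'n::finite) measure \<Rightarrow> real \<Rightarrow> real \<Rightarrow> bool" where
  "grad_controls M p q \<longleftrightarrow> (\<exists>C>0. \<forall>u\<in>Ccinf.
     (\<integral>x. \<bar>u x\<bar> powr q \<partial>M) \<le> C * Lp_norm M p (\<lambda>x. norm (grad u x)) powr q)"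

lemma grad_controlsI:
  fixes M :: "(real^'n::finite) measure"
  assumes "\<And>u. u \<in> Ccinf \<Longrightarrow> (\<integral>x. \<bar>u x\<bar> powr q \<partial>M) \<le> C * Lp_norm M p (\<lambda>x. norm (grad u x)) powr q"
  shows "grad_controls M p q"
  unfolding grad_controls_def
proof (intro exI[of _ "max C 1"] conjI ballI)
  fix u :: "real^'n \<Rightarrow> real" assume "u \<in> Ccinf"
  from assms[OF this] show "(\<integral>x. \<bar>u x\<bar> powr q \<partial>M) \<le> max C 1 * Lp_norm M p (\<lambda>x. norm (grad u x)) powr q"
    by (rule order_trans) (intro mult_right_mono, auto)
qed simp

lemma grad_controls_Lp_norm:
  fixes M :: "(real^'n::finite) measure"
  assumes "grad_controls M p q" and q: "q > 0"
  shows "\<exists>C>0. \<forall>u\<in>Ccinf. Lp_norm M p (\<lambda>x. norm (grad u x)) \<ge> C * Lp_norm M q u"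
proof -
  obtain C where C: "C > 0"
    "\<forall>u\<in>Ccinf. (\<integral>x. \<bar>u x\<bar> powr q \<partial>M) \<le> C * Lp_norm M p (\<lambda>x. norm (grad u x)) powr q"
    using assms(1) unfolding grad_controls_def by blast
  show ?thesis
  proof (intro exI[of _ "1 / C powr (1 / q)"] conjI ballI)
    fix u :: "real^'n \<Rightarrow> real" assume u: "u \<in> Ccinf"
    let ?G = "Lp_norm M p (\<lambda>x. norm (grad u x))"
    have "Lp_norm M q u \<le> (C * ?G powr q) powr (1 / q)"
      using C(2) u q unfolding Lp_norm_def[of M q u] by (intro powr_mono2) auto
    also have "\<dots> = C powr (1 / q) * ?G"
      using C(1) q Lp_norm_nonneg[of M p "\<lambda>x. norm (grad u x)"] by (simp add: powr_mult powr_powr)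
    finally show "1 / C powr (1 / q) * Lp_norm M q u \<le> ?G"
      using C(1) by (simp add: field_simps)
  qed (use C in simp)
qed

text \<open>Settles the degenerate case of a vanishing gradient norm in the interpolation: one
  vanishing power integral forces \<open>u = 0\<close> almost everywhere.\<close>

lemma gauss_integral_powr_eq_0:
  assumes u: "u \<in> Ccinf" and a: "a > 0" "q > 0" and z: "(\<integral>x. \<bar>u x\<bar> powr a \<partial>gauss_measure c) \<le> 0"
  shows "(\<integral>x. \<bar>u x\<bar> powr q \<partial>gauss_measure c) = 0"
proof -
  have "(\<integral>x. \<bar>u x\<bar> powr a \<partial>gauss_measure c) = 0"
    using z by (intro antisym) auto
  then have "AE x in gauss_measure c. \<bar>u x\<bar> powr a = 0"
    using Ccinf_integrable_powr(1)[OF u a(1)] by (subst (asm) integral_nonneg_eq_0_iff_AE) auto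
  then have "AE x in gauss_measure c. \<bar>u x\<bar> powr q = 0"
    by eventually_elim auto
  then show ?thesis
    by (rule integral_eq_zero_AE)
qed

text \<open>The values of \<open>u\<close> are split at the level \<open>G\<close>, the gradient
  norm itself. Below it \<open>q - a \<ge> 0\<close> and above it \<open>q - b \<le> 0\<close> bound
  the surplus power, and by this choice of level both resulting terms are multiples of
  \<open>G powr q\<close>.\<close>

lemma grad_controls_interpolate:
  fixes c :: real
  defines "M \<equiv> gauss_measure c :: (real^'n::finite) measure"
  assumes "grad_controls M p a" "grad_controls M p b" and q: "0 < a" "a \<le> q" "q \<le> b"
  shows "grad_controls M p q"
proof -
  obtain A where A: "\<forall>u\<in>Ccinf. (\<integral>x. \<bar>u x\<bar> powr a \<partial>M) \<le> A * Lp_norm M p (\<lambda>x. norm (grad u x)) powr a"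
    using assms(2) unfolding grad_controls_def by blast
  obtain B where B: "\<forall>u\<in>Ccinf. (\<integral>x. \<bar>u x\<bar> powr b \<partial>M) \<le> B * Lp_norm M p (\<lambda>x. norm (grad u x)) powr b"
    using assms(3) unfolding grad_controls_def by blast
  show ?thesis
  proof (rule grad_controlsI[where C = "A + B"])
    fix u :: "real^'n \<Rightarrow> real" assume u: "u \<in> Ccinf"
    define G where "G = Lp_norm M p (\<lambda>x. norm (grad u x))"
    have G: "G \<ge> 0" by (simp add: G_def Lp_norm_nonneg)
    have int: "integrable M (\<lambda>x. \<bar>u x\<bar> powr r)" if "r > 0" for r
      unfolding M_def using u that by (rule Ccinf_integrable_powr)
    show "(\<integral>x. \<bar>u x\<bar> powr q \<partial>M) \<le> (A + B) * G powr q"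
    \<comment> \<open>The level enters with the exponent \<open>q - b\<close>, which may be
      negative, so \<open>G = 0\<close> is separate; there the bound for the exponent
      \<open>a\<close> says that the integral of \<open>\<bar>u x\<bar> powr a\<close>
      vanishes.\<close>
    proof (cases "G = 0")
      case True
      then show ?thesis
        using gauss_integral_powr_eq_0[OF u, of a q c] A u q by (auto simp: G_def M_def)
    next
      case False
      with G have G: "G > 0" by simp
      have "\<bar>u x\<bar> powr q \<le> G powr (q - a) * \<bar>u x\<bar> powr a + G powr (q - b) * \<bar>u x\<bar> powr b" for x
      proof (cases "u x = 0")
        case ux: False
        show ?thesis
        proof (cases "\<bar>u x\<bar> \<le> G")
          case True
          have "\<bar>u x\<bar> powr (q - a) \<le> G powr (q - a)"
            using True q by (intro powr_mono2) auto
          then have "\<bar>u x\<bar> powr (q - a) * \<bar>u x\<bar> powr a \<le> G powr (q - a) * \<bar>u x\<bar> powr a"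
            by (intro mult_right_mono) auto
          then have "\<bar>u x\<bar> powr q \<le> G powr (q - a) * \<bar>u x\<bar> powr a"
            using ux by (simp flip: powr_add)
          moreover have "0 \<le> G powr (q - b) * \<bar>u x\<bar> powr b" by simp
          ultimately show ?thesis by linarith
        next
          case False
          have "\<bar>u x\<bar> powr (q - b) \<le> G powr (q - b)"
            using False q G by (intro powr_mono2') auto
          then have "\<bar>u x\<bar> powr (q - b) * \<bar>u x\<bar> powr b \<le> G powr (q - b) * \<bar>u x\<bar> powr b"
            by (intro mult_right_mono) auto
          then have "\<bar>u x\<bar> powr q \<le> G powr (q - b) * \<bar>u x\<bar> powr b"
            using ux by (simp flip: powr_add)
          moreover have "0 \<le> G powr (q - a) * \<bar>u x\<bar> powr a" by simp
          ultimately show ?thesis by linarith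
        qed
      qed (use q in auto)
      then have "(\<integral>x. \<bar>u x\<bar> powr q \<partial>M) \<le> (\<integral>x. G powr (q - a) * \<bar>u x\<bar> powr a + G powr (q - b) * \<bar>u x\<bar> powr b \<partial>M)"
        using q by (intro integral_mono int Bochner_Integration.integrable_add integrable_mult_right) auto
      also have "\<dots> = G powr (q - a) * (\<integral>x. \<bar>u x\<bar> powr a \<partial>M) + G powr (q - b) * (\<integral>x. \<bar>u x\<bar> powr b \<partial>M)"
        using q by (subst Bochner_Integration.integral_add) (auto intro!: int)
      also have "\<dots> \<le> G powr (q - a) * (A * G powr a) + G powr (q - b) * (B * G powr b)"
        using A B u by (intro add_mono mult_left_mono) (auto simp: G_def)
      also have "\<dots> = A * (G powr (q - a) * G powr a) + B * (G powr (q - b) * G powr b)"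
        by (simp add: algebra_simps)
      also have "\<dots> = (A + B) * G powr q"
        using G by (simp add: algebra_simps flip: powr_add)
      finally show ?thesis .
    qed
  qed
qed

text \<open>Division by \<open>U powr s\<close>, for use where an integral is bounded by a smaller
  power of itself.\<close>

lemma powr_absorb:
  fixes U X s :: real
  assumes U: "U \<ge> 0" "X \<ge> 0" and s: "s < 1" and le: "U \<le> X * U powr s"
  shows "U \<le> X powr (1 / (1 - s))"
proof (cases "U = 0")
  case False
  with U have "U > 0" by simp
  have "U powr (1 - s) = U / U powr s" using \<open>U > 0\<close> by (simp add: powr_diff)
  also have "\<dots> \<le> X" using le \<open>U > 0\<close> by (simp add: field_simps)
  finally have "(U powr (1 - s)) powr (1 / (1 - s)) \<le> X powr (1 / (1 - s))"
    using s by (intro powr_mono2) auto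
  then show ?thesis using s \<open>U > 0\<close> by (simp add: powr_powr)
qed (use U in auto)

section \<open>Sobolev exponents for \<open>p < n\<close> and \<open>p = n\<close>\<close>

text \<open>In the Poincare inequality the choice \<open>\<gamma> = p\<close> makes
  \<open>(\<gamma> - 1) * p / (p - 1) = p\<close>. For \<open>p > 1\<close> Hoelder's inequality
  thus returns the integral on the left to the power \<open>(p - 1) / p < 1\<close>, which is
  absorbed.\<close>

lemma grad_controls_self:
  fixes c :: real
  assumes c: "c > 0" and p: "p \<ge> 1"
  shows "grad_controls (gauss_measure c :: (real^'n::finite) measure) p p"
proof (rule grad_controlsI[where C = "(exp c / c * p) powr p"])
  fix u :: "real^'n \<Rightarrow> real" assume u: "u \<in> Ccinf"
  let ?M = "gauss_measure c :: (real^'n) measure"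
  define K where "K = exp c / c"
  define G where "G = Lp_norm ?M p (\<lambda>x. norm (grad u x))"
  define U where "U = (\<integral>x. \<bar>u x\<bar> powr p \<partial>?M)"
  have K: "K > 0" using c by (simp add: K_def)
  have G: "G \<ge> 0" by (simp add: G_def Lp_norm_nonneg)
  have U: "U \<ge> 0" by (simp add: U_def)
  have le: "ennreal U \<le> ennreal K * (\<integral>\<^sup>+x. grad_abs_powr p u x \<partial>?M)"
    using gauss_weighted_Poincare[OF c u p] Ccinf_nn_integral_powr(1)[OF u, of p c] p
    by (simp add: U_def K_def)
  show "U \<le> (K * p) powr p * G powr p"
  proof (cases "p = 1")
    case True
    have "ennreal U \<le> ennreal (K * G)"
      using le K G True nn_integral_grad_abs_powr_1[OF u, of c] by (simp add: G_def ennreal_mult)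
    then show ?thesis using True K G by (simp add: ennreal_le_iff)
  next
    case False
    with p have p: "p > 1" by simp
    have "(p - 1) * p / (p - 1) = p" using p by simp
    then have "(\<integral>\<^sup>+x. grad_abs_powr p u x \<partial>?M) \<le> ennreal (p * U powr ((p - 1) / p) * G)"
      using nn_integral_grad_abs_powr_le[OF u p p, of c] by (simp add: U_def G_def)
    then have "ennreal K * (\<integral>\<^sup>+x. grad_abs_powr p u x \<partial>?M) \<le> ennreal K * ennreal (p * U powr ((p - 1) / p) * G)"
      by (intro mult_left_mono) auto
    with le have "ennreal U \<le> ennreal K * ennreal (p * U powr ((p - 1) / p) * G)"
      by (rule order_trans)
    also have "\<dots> = ennreal ((K * p * G) * U powr ((p - 1) / p))"
      using K p G by (simp add: ac_simps flip: ennreal_mult)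
    finally have "U \<le> (K * p * G) * U powr ((p - 1) / p)"
      using K p G by (simp add: ennreal_le_iff)
    then have "U \<le> (K * p * G) powr (1 / (1 - (p - 1) / p))"
      using U K p G by (intro powr_absorb) (auto simp: field_simps)
    also have "1 / (1 - (p - 1) / p) = p" using p by (simp add: field_simps)
    finally show ?thesis using K p G by (simp add: powr_mult)
  qed
qed

text \<open>One step from the exponent \<open>(\<gamma> - 1) * p / (p - 1)\<close> to
  \<open>\<gamma> * r\<close>. For \<open>1 < p < n\<close> a suitable \<open>\<gamma>\<close> makes
  the two agree; for \<open>p = n\<close> the second always exceeds the first by
  \<open>r\<close>.\<close>

lemma gauss_Sobolev_step:
  fixes u :: "real^'n::finite \<Rightarrow> real"
  assumes n2: "CARD('n) \<ge> 2" and c: "c > 0" and u: "u \<in> Ccinf" and p: "p > 1" and \<gamma>: "\<gamma> > 1"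
  defines "r \<equiv> real CARD('n) / (real CARD('n) - 1)"
  shows "(\<integral>x. \<bar>u x\<bar> powr (\<gamma> * r) \<partial>gauss_measure c)
    \<le> (\<gamma> * (\<integral>x. \<bar>u x\<bar> powr ((\<gamma> - 1) * p / (p - 1)) \<partial>gauss_measure c) powr ((p - 1) / p)
        * Lp_norm (gauss_measure c) p (\<lambda>x. norm (grad u x))) powr r" (is "?U \<le> ?X powr r")
proof -
  have r: "r > 0" using n2 by (simp add: r_def)
  have X: "?X \<ge> 0" using \<gamma> by (simp add: Lp_norm_nonneg)
  have "ennreal ?U = (\<integral>\<^sup>+x. ennreal (\<bar>u x\<bar> powr (\<gamma> * r)) \<partial>gauss_measure c)"
    using \<gamma> r by (simp add: Ccinf_nn_integral_powr(1)[OF u])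
  also have "\<dots> \<le> epowr (\<integral>\<^sup>+x. grad_abs_powr \<gamma> u x \<partial>gauss_measure c) r"
    unfolding r_def using \<gamma> by (intro gauss_weighted_Gagliardo_Nirenberg n2 c u) auto
  also have "\<dots> \<le> epowr (ennreal ?X) r"
    using r by (intro epowr_mono nn_integral_grad_abs_powr_le u p \<gamma>) auto
  also have "\<dots> = ennreal (?X powr r)"
    using X r by (intro epowr_ennreal) auto
  finally show ?thesis by (simp add: ennreal_le_iff)
qed

lemma grad_controls_critical:
  fixes c p :: real
  defines "n \<equiv> real CARD('n)"
  assumes n2: "CARD('n::finite) \<ge> 2" and c: "c > 0" and p: "p \<ge> 1" "p < n"
  shows "grad_controls (gauss_measure c :: (real^'n) measure) p (n * p / (n - p))"
proof -
  let ?M = "gauss_measure c :: (real^'n) measure"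
  define r where "r = n / (n - 1)"
  have n: "n \<ge> 2" using n2 by (simp add: n_def)
  have r: "r > 0" using n by (simp add: r_def)
  show ?thesis
  \<comment> \<open>For \<open>p = 1\<close> the critical exponent is \<open>r\<close>, and the
    weighted Gagliardo-Nirenberg inequality with \<open>\<gamma> = 1\<close> is already the
    claim.\<close>
  proof (cases "p = 1")
    case True
    show ?thesis
    proof (rule grad_controlsI[where C=1])
      fix u :: "real^'n \<Rightarrow> real" assume u: "u \<in> Ccinf"
      have "ennreal (\<integral>x. \<bar>u x\<bar> powr (1 * r) \<partial>?M) \<le> epowr (\<integral>\<^sup>+x. grad_abs_powr 1 u x \<partial>?M) r"
        using gauss_weighted_Gagliardo_Nirenberg[OF n2 c u, of 1] r
        by (simp add: Ccinf_nn_integral_powr(1)[OF u] r_def n_def)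
      also have "\<dots> = ennreal (Lp_norm ?M 1 (\<lambda>x. norm (grad u x)) powr r)"
        using r by (simp add: nn_integral_grad_abs_powr_1[OF u] epowr_ennreal Lp_norm_nonneg)
      finally show "(\<integral>x. \<bar>u x\<bar> powr (n * p / (n - p)) \<partial>?M)
          \<le> 1 * Lp_norm ?M p (\<lambda>x. norm (grad u x)) powr (n * p / (n - p))"
        using True by (simp add: ennreal_le_iff r_def)
    qed
  next
    case False
    with p have p: "p > 1" "p < n" by auto
    \<comment> \<open>The solution of \<open>\<gamma> * r = (\<gamma> - 1) * p / (p - 1)\<close>;
      the common value of both sides is the critical exponent \<open>q\<close>.\<close>
    define \<gamma> where "\<gamma> = p * (n - 1) / (n - p)"
    define q where "q = n * p / (n - p)"
    have \<gamma>: "\<gamma> > 1" using p n by (simp add: \<gamma>_def field_simps)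
    have "p * d / e * (n / d) = n * p / e" if "d \<noteq> 0" for d e :: real
      using that by simp
    from this[of "n - 1" "n - p"] have q: "\<gamma> * r = q"
      using n by (simp add: \<gamma>_def r_def q_def)
    have "\<gamma> - 1 = n * (p - 1) / (n - p)" using p by (simp add: \<gamma>_def field_simps)
    then have q': "(\<gamma> - 1) * p / (p - 1) = q" using p by (simp add: q_def)
    \<comment> \<open>The power to which the integral \<open>U\<close> occurs on the right; it can
      be absorbed because \<open>p < n\<close> makes \<open>1 - s\<close> positive.\<close>
    define s where "s = (p - 1) / p * r"
    have s: "1 - s = (n - p) / (p * (n - 1))"
    proof -
      have "1 - (p - 1) / p * ((d + 1) / d) = (d + 1 - p) / (p * d)" if "d \<noteq> 0" for d :: real
        using that p by (simp add: field_simps)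
      from this[of "n - 1"] show ?thesis
        using n by (simp add: s_def r_def)
    qed
    have "(n - p) / (p * (n - 1)) > 0" using p n by simp
    then have s1: "s < 1" using s by linarith
    \<comment> \<open>After the absorption the gradient norm carries the exponent
      \<open>r / (1 - s)\<close>, which has to be \<open>q\<close> by homogeneity.\<close>
    have rs: "r * (1 / (1 - s)) = q"
    proof -
      have "n / d * (1 / (e / (p * d))) = n * p / e" if "d \<noteq> 0" "e \<noteq> 0" for d e :: real
        using that p by (simp add: field_simps)
      from this[of "n - 1" "n - p"] show ?thesis
        unfolding s r_def q_def using p n by simp
    qed
    show ?thesis
    proof (rule grad_controlsI[where C="\<gamma> powr q"])
      fix u :: "real^'n \<Rightarrow> real" assume u: "u \<in> Ccinf"
      define G where "G = Lp_norm ?M p (\<lambda>x. norm (grad u x))"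
      define U where "U = (\<integral>x. \<bar>u x\<bar> powr q \<partial>?M)"
      have G: "G \<ge> 0" by (simp add: G_def Lp_norm_nonneg)
      have U: "U \<ge> 0" by (simp add: U_def)
      have "U \<le> (\<gamma> * U powr ((p - 1) / p) * G) powr r"
        using gauss_Sobolev_step[OF n2 c u p(1) \<gamma>]
        by (simp only: r_def[symmetric] n_def[symmetric] q q' U_def[symmetric] G_def[symmetric])
      also have "\<dots> = (\<gamma> * G) powr r * U powr s"
        using \<gamma> G U by (simp add: powr_mult powr_powr s_def)
      finally have "U \<le> ((\<gamma> * G) powr r) powr (1 / (1 - s))"
        using U s1 by (intro powr_absorb) auto
      also have "\<dots> = \<gamma> powr q * G powr q"
        using \<gamma> G by (simp only: powr_powr rs) (simp add: powr_mult)
      finally show "(\<integral>x. \<bar>u x\<bar> powr (n * p / (n - p)) \<partial>?M)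
          \<le> \<gamma> powr q * Lp_norm ?M p (\<lambda>x. norm (grad u x)) powr (n * p / (n - p))"
        by (simp add: U_def G_def q_def)
    qed
  qed
qed

text \<open>A bound for the exponent \<open>a\<close> gives one for \<open>a + r\<close>. Starting
  from the Poincare bound at \<open>n\<close>, the exponents \<open>n + real k * r\<close> are
  unbounded, and interpolation with \<open>n\<close> fills the gaps.\<close>

lemma grad_controls_limiting:
  fixes c :: real
  defines "n \<equiv> real CARD('n)"
  assumes n2: "CARD('n::finite) \<ge> 2" and c: "c > 0" and q: "n \<le> q"
  shows "grad_controls (gauss_measure c :: (real^'n) measure) n q"
proof -
  let ?M = "gauss_measure c :: (real^'n) measure"
  define r where "r = n / (n - 1)"
  have n: "n \<ge> 2" using n2 by (simp add: n_def)
  have r: "r \<ge> 1" using n by (simp add: r_def field_simps)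
  have step: "grad_controls ?M n (a + r)" if a: "a > 0" and A: "grad_controls ?M n a" for a
  proof -
    \<comment> \<open>Chosen so that the integral produced by Hoelder's inequality has exponent
      exactly \<open>a\<close>; it then enters to the first power, because
      \<open>(n - 1) / n * r = 1\<close>.\<close>
    define \<gamma> where "\<gamma> = a / r + 1"
    have \<gamma>: "\<gamma> > 1" "\<gamma> * r = a + r" using a r by (auto simp: \<gamma>_def field_simps)
    have e: "(\<gamma> - 1) * n / (n - 1) = a" "(n - 1) / n * r = 1"
      using n by (auto simp: \<gamma>_def r_def)
    obtain C where C: "C > 0" "\<forall>u\<in>Ccinf. (\<integral>x. \<bar>u x\<bar> powr a \<partial>?M) \<le> C * Lp_norm ?M n (\<lambda>x. norm (grad u x)) powr a"
      using A unfolding grad_controls_def by blast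
    show ?thesis
    proof (rule grad_controlsI[where C="\<gamma> powr r * C"])
      fix u :: "real^'n \<Rightarrow> real" assume u: "u \<in> Ccinf"
      define G where "G = Lp_norm ?M n (\<lambda>x. norm (grad u x))"
      define U where "U a = (\<integral>x. \<bar>u x\<bar> powr a \<partial>?M)" for a
      have G: "G \<ge> 0" by (simp add: G_def Lp_norm_nonneg)
      have U: "U a \<ge> 0" for a by (simp add: U_def)
      have "n > 1" using n by simp
      from gauss_Sobolev_step[OF n2 c u this \<gamma>(1)]
      have "U (a + r) \<le> (\<gamma> * U a powr ((n - 1) / n) * G) powr r"
        by (simp only: r_def[symmetric] n_def[symmetric] \<gamma>(2) e U_def[symmetric] G_def[symmetric])
      also have "\<dots> = \<gamma> powr r * U a * G powr r"
        using \<gamma> G U[of a] e(2) by (simp add: powr_mult powr_powr)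
      also have "\<dots> \<le> \<gamma> powr r * (C * G powr a) * G powr r"
        using C(2) u by (intro mult_right_mono mult_left_mono) (auto simp: U_def G_def)
      also have "\<dots> = \<gamma> powr r * C * G powr (a + r)"
        by (simp add: powr_add)
      finally show "(\<integral>x. \<bar>u x\<bar> powr (a + r) \<partial>?M) \<le> \<gamma> powr r * C * Lp_norm ?M n (\<lambda>x. norm (grad u x)) powr (a + r)"
        by (simp add: U_def G_def)
    qed
  qed
  have n_n: "grad_controls ?M n n"
    using c n by (intro grad_controls_self) auto
  have "grad_controls ?M n (n + real k * r)" for k
  proof (induction k)
    case (Suc k)
    have "n + real k * r > 0" using n r by (intro add_pos_nonneg) auto
    from step[OF this Suc.IH] show ?case by (simp add: algebra_simps)
  qed (use n_n in simp)
  moreover obtain k :: nat where k: "q \<le> real k" using real_arch_simple by blast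
  ultimately have "grad_controls ?M n (n + real k * r)" by simp
  moreover have "q \<le> n + real k * r"
    using k n r mult_left_mono[of 1 r "real k"] by simp
  ultimately show ?thesis
    using n_n q n by (auto intro: grad_controls_interpolate[OF n_n])
qed

section \<open>Morrey's inequality\<close>

lemma nn_integral_lborel_le_gauss_measure:
  fixes f :: "real^'n::finite \<Rightarrow> ennreal"
  assumes c: "c > 0" and [measurable]: "f \<in> borel_measurable borel"
  shows "(\<integral>\<^sup>+x. f x \<partial>lborel) \<le> (\<integral>\<^sup>+x. f x \<partial>gauss_measure c)"
proof -
  have "1 * f x \<le> ennreal (exp (c * (norm x)\<^sup>2)) * f x" for x
    using c by (intro mult_right_mono) (auto simp: ennreal_1[symmetric] simp del: ennreal_1 intro!: ennreal_leI)
  then show ?thesis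
    by (simp add: nn_integral_gauss_measure nn_integral_mono)
qed

lemma nn_integral_lborel_dilation:
  fixes H :: "real^'n::finite \<Rightarrow> ennreal"
  assumes [measurable]: "H \<in> borel_measurable borel" and t: "t > 0"
  shows "(\<integral>\<^sup>+y. H (x + t *\<^sub>R (y - x)) \<partial>lborel) = ennreal (t powr - real CARD('n)) * (\<integral>\<^sup>+y. H y \<partial>lborel)"
proof -
  define d where "d = t ^ CARD('n)"
  have d: "d > 0" "t powr - real CARD('n) = 1 / d"
    using t by (auto simp: d_def powr_minus powr_realpow divide_inverse)
  have "(\<integral>\<^sup>+y. H y \<partial>lborel)
      = (\<integral>\<^sup>+y. H y \<partial>density (distr lborel borel (\<lambda>y. (x - t *\<^sub>R x) + t *\<^sub>R y)) (\<lambda>_. \<bar>t\<bar> ^ DIM(real^'n)))"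
    using t by (subst lborel_affine[of t "x - t *\<^sub>R x"]) auto
  also have "\<dots> = (\<integral>\<^sup>+y. ennreal d * H ((x - t *\<^sub>R x) + t *\<^sub>R y) \<partial>lborel)"
    using t by (simp add: nn_integral_density nn_integral_distr d_def)
  also have "\<dots> = ennreal d * (\<integral>\<^sup>+y. H ((x - t *\<^sub>R x) + t *\<^sub>R y) \<partial>lborel)"
    by (rule nn_integral_cmult) measurable
  finally have "(\<integral>\<^sup>+y. H y \<partial>lborel) = ennreal d * (\<integral>\<^sup>+y. H (x + t *\<^sub>R (y - x)) \<partial>lborel)"
    by (simp add: algebra_simps)
  then have "ennreal (1 / d) * (\<integral>\<^sup>+y. H y \<partial>lborel) = ennreal (1 / d * d) * (\<integral>\<^sup>+y. H (x + t *\<^sub>R (y - x)) \<partial>lborel)"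
    using d by (subst ennreal_mult) (auto simp: mult.assoc)
  then show ?thesis using d by simp
qed

text \<open>Hoelder's inequality is applied in \<open>y\<close> for each fixed \<open>t\<close>, before rescaling; extending the
  gradient integral to the whole space avoids dilated balls and leaves the factor
  \<open>t powr (-n/p)\<close>, which is integrable on \<open>[0,1]\<close> exactly because \<open>p > n\<close>.\<close>

lemma Morrey_ball_average:
  fixes u :: "real^'n::finite \<Rightarrow> real" and z x :: "real^'n"
  defines "n \<equiv> real CARD('n)"
  assumes u: "u \<in> Ccinf" and p: "p > n" and x: "x \<in> ball z \<rho>"
  shows "(\<integral>\<^sup>+y. indicator (ball z \<rho>) y * ennreal \<bar>u y - u x\<bar> \<partial>lborel)
    \<le> ennreal (2 * \<rho> / (1 - n / p)) * (epowr (emeasure lborel (ball z \<rho>)) (1 - 1 / p)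
        * epowr (\<integral>\<^sup>+y. ennreal (norm (grad u y) powr p) \<partial>lborel) (1 / p))"
proof -
  note [measurable] = Ccinf_measurable[OF u]
  define S where "S = ball z \<rho>"
  define h where "h y = ennreal (norm (grad u y))" for y
  define V where "V = (\<integral>\<^sup>+y. ennreal (norm (grad u y) powr p) \<partial>lborel)"
  define E where "E = epowr (emeasure lborel S) (1 - 1 / p) * epowr V (1 / p)"
  have n1: "n \<ge> 1" by (simp add: n_def Suc_le_eq)
  then have p1: "p > 1" using p by simp
  have np: "n / p < 1" using p n1 by simp
  have \<rho>: "\<rho> > 0" using x by (auto intro: le_less_trans[OF zero_le_dist])
  have [measurable]: "S \<in> sets borel" by (simp add: S_def)
  have [measurable]: "h \<in> borel_measurable borel" unfolding h_def by measurable
  have "continuous_on UNIV (\<lambda>w :: (real^'n) \<times> real. x + snd w *\<^sub>R (fst w - x))"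
    by (intro continuous_intros)
  then have [measurable]: "(\<lambda>w :: (real^'n) \<times> real. x + snd w *\<^sub>R (fst w - x)) \<in> borel_measurable borel"
    by (rule borel_measurable_continuous_onI)
  have "(\<lambda>w :: (real^'n) \<times> real. h (x + snd w *\<^sub>R (fst w - x))) \<in> borel_measurable borel"
    by measurable
  then have hm [measurable]:
    "(\<lambda>w :: (real^'n) \<times> real. h (x + snd w *\<^sub>R (fst w - x))) \<in> borel_measurable (lborel \<Otimes>\<^sub>M lborel)"
    by (simp add: lborel_prod)
  \<comment> \<open>The increment of \<open>u\<close> along the segment from \<open>x\<close> to
    \<open>y\<close>, whose length is at most the diameter \<open>2 * \<rho>\<close> of the
    ball.\<close>
  have seg: "ennreal \<bar>u y - u x\<bar> \<le> ennreal (2 * \<rho>) * (\<integral>\<^sup>+t. h (x + t *\<^sub>R (y - x)) * indicator {0..1} t \<partial>lborel)"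
    if y: "y \<in> S" for y
  proof -
    have dist: "norm (y - x) \<le> 2 * \<rho>"
    proof -
      have "dist y x \<le> dist y z + dist z x" by (rule dist_triangle)
      then show ?thesis using x y by (simp add: S_def dist_norm norm_minus_commute)
    qed
    have g: "((\<lambda>t. u (x + t *\<^sub>R (y - x))) has_real_derivative (grad u (x + t *\<^sub>R (y - x)) \<bullet> (y - x))) (at t)" for t
      by (rule Ccinf_line_derivative[OF u])
    have le: "\<bar>grad u (x + t *\<^sub>R (y - x)) \<bullet> (y - x)\<bar> \<le> 2 * \<rho> * norm (grad u (x + t *\<^sub>R (y - x)))" for t
      using order_trans[OF Cauchy_Schwarz_ineq2 mult_left_mono[OF dist norm_ge_zero], of "grad u (x + t *\<^sub>R (y - x))"]
      by (simp add: mult.commute)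
    have line: "continuous_on UNIV (\<lambda>t. x + t *\<^sub>R (y - x))" by (intro continuous_intros)
    have cont: "continuous_on UNIV (\<lambda>t. 2 * \<rho> * norm (grad u (x + t *\<^sub>R (y - x))))"
      by (intro continuous_intros continuous_on_compose2[OF Ccinf_continuous_grad[OF u] line subset_UNIV])
    have "ennreal \<bar>u (x + 1 *\<^sub>R (y - x)) - u (x + 0 *\<^sub>R (y - x))\<bar>
        \<le> (\<integral>\<^sup>+t. ennreal (2 * \<rho> * norm (grad u (x + t *\<^sub>R (y - x)))) * indicator {0..1} t \<partial>lborel)"
      by (rule increment_le_nn_integral[OF _ g le cont]) simp
    also have "\<dots> = (\<integral>\<^sup>+t. ennreal (2 * \<rho>) * (h (x + t *\<^sub>R (y - x)) * indicator {0..1} t) \<partial>lborel)"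
      using \<rho> by (simp add: h_def ennreal_mult mult.assoc)
    also have "\<dots> = ennreal (2 * \<rho>) * (\<integral>\<^sup>+t. h (x + t *\<^sub>R (y - x)) * indicator {0..1} t \<partial>lborel)"
      by (rule nn_integral_cmult) measurable
    finally show ?thesis by simp
  qed
  have slice: "(\<integral>\<^sup>+y. indicator S y * h (x + t *\<^sub>R (y - x)) \<partial>lborel) \<le> ennreal (t powr - (n / p)) * E"
    if t: "t > 0" for t
  proof -
    have "(\<integral>\<^sup>+y. indicator S y * h (x + t *\<^sub>R (y - x)) \<partial>lborel)
        = (\<integral>\<^sup>+y. epowr (indicator S y) (1 - 1 / p) * epowr (ennreal (norm (grad u (x + t *\<^sub>R (y - x))) powr p)) (1 / p) \<partial>lborel)"
      using p1 by (intro nn_integral_cong) (auto simp: h_def indicator_def epowr_ennreal powr_powr epowr_ennreal_pos[of 1, simplified])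
    also have "\<dots> \<le> epowr (\<integral>\<^sup>+y. indicator S y \<partial>lborel) (1 - 1 / p)
        * epowr (\<integral>\<^sup>+y. ennreal (norm (grad u (x + t *\<^sub>R (y - x))) powr p) \<partial>lborel) (1 / p)"
      using p1 by (intro Holder_nn_integral) auto
    also have "(\<integral>\<^sup>+y. indicator S y \<partial>lborel) = emeasure lborel S" by simp
    also have "(\<integral>\<^sup>+y. ennreal (norm (grad u (x + t *\<^sub>R (y - x))) powr p) \<partial>lborel) = ennreal (t powr - n) * V"
      unfolding V_def n_def using t by (intro nn_integral_lborel_dilation) auto
    also have "epowr (ennreal (t powr - n) * V) (1 / p) = ennreal (t powr - (n / p)) * epowr V (1 / p)"
      using p1 by (simp add: epowr_mult epowr_ennreal powr_powr)
    finally show ?thesis by (simp add: E_def ac_simps)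
  qed
  have "(\<integral>\<^sup>+y. indicator S y * ennreal \<bar>u y - u x\<bar> \<partial>lborel)
      \<le> (\<integral>\<^sup>+y. \<integral>\<^sup>+t. ennreal (2 * \<rho>) * (indicator S y * (h (x + t *\<^sub>R (y - x)) * indicator {0..1} t)) \<partial>lborel \<partial>lborel)"
  proof (intro nn_integral_mono)
    fix y
    have "indicator S y * ennreal \<bar>u y - u x\<bar>
        \<le> indicator S y * (ennreal (2 * \<rho>) * (\<integral>\<^sup>+t. h (x + t *\<^sub>R (y - x)) * indicator {0..1} t \<partial>lborel))"
      using seg[of y] by (auto simp: indicator_def)
    also have "\<dots> = (\<integral>\<^sup>+t. ennreal (2 * \<rho>) * (indicator S y * (h (x + t *\<^sub>R (y - x)) * indicator {0..1} t)) \<partial>lborel)"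
      by (simp add: nn_integral_cmult mult.left_commute)
    finally show "indicator S y * ennreal \<bar>u y - u x\<bar>
      \<le> (\<integral>\<^sup>+t. ennreal (2 * \<rho>) * (indicator S y * (h (x + t *\<^sub>R (y - x)) * indicator {0..1} t)) \<partial>lborel)" .
  qed
  also have "\<dots> = (\<integral>\<^sup>+t. \<integral>\<^sup>+y. ennreal (2 * \<rho>) * (indicator S y * (h (x + t *\<^sub>R (y - x)) * indicator {0..1} t)) \<partial>lborel \<partial>lborel)"
  proof (rule lborel_pair.Fubini'[symmetric])
    show "(\<lambda>(y, t). ennreal (2 * \<rho>) * (indicator S y * (h (x + t *\<^sub>R (y - x)) * indicator {0..1} t)))
      \<in> borel_measurable (lborel \<Otimes>\<^sub>M lborel)"
      using hm unfolding split_beta' by measurable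
  qed
  also have "\<dots> = (\<integral>\<^sup>+t. ennreal (2 * \<rho>) * (indicator {0..1} t * (\<integral>\<^sup>+y. indicator S y * h (x + t *\<^sub>R (y - x)) \<partial>lborel)) \<partial>lborel)"
  proof (intro nn_integral_cong)
    fix t :: real
    have "(\<integral>\<^sup>+y. ennreal (2 * \<rho>) * (indicator S y * (h (x + t *\<^sub>R (y - x)) * indicator {0..1} t)) \<partial>lborel)
        = (\<integral>\<^sup>+y. (ennreal (2 * \<rho>) * indicator {0..1} t) * (indicator S y * h (x + t *\<^sub>R (y - x))) \<partial>lborel)"
      by (simp add: ac_simps)
    also have "\<dots> = (ennreal (2 * \<rho>) * indicator {0..1} t) * (\<integral>\<^sup>+y. indicator S y * h (x + t *\<^sub>R (y - x)) \<partial>lborel)"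
      by (rule nn_integral_cmult) measurable
    finally show "(\<integral>\<^sup>+y. ennreal (2 * \<rho>) * (indicator S y * (h (x + t *\<^sub>R (y - x)) * indicator {0..1} t)) \<partial>lborel)
        = ennreal (2 * \<rho>) * (indicator {0..1} t * (\<integral>\<^sup>+y. indicator S y * h (x + t *\<^sub>R (y - x)) \<partial>lborel))"
      by (simp add: mult.assoc)
  qed
  also have "\<dots> \<le> (\<integral>\<^sup>+t. (ennreal (2 * \<rho>) * E) * (ennreal (t powr - (n / p)) * indicator {0..1} t) \<partial>lborel)"
  \<comment> \<open>The rescaled bound needs \<open>t > 0\<close>, and
    \<open>0 powr - (n / p)\<close> is 0 by convention, so the point \<open>t = 0\<close> is
    discarded as a null set.\<close>
  proof (rule nn_integral_mono_AE)
    show "AE t in lborel. ennreal (2 * \<rho>) * (indicator {0..1} t * (\<integral>\<^sup>+y. indicator S y * h (x + t *\<^sub>R (y - x)) \<partial>lborel))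
        \<le> (ennreal (2 * \<rho>) * E) * (ennreal (t powr - (n / p)) * indicator {0..1} t)"
      using AE_lborel_singleton[of "0::real"]
    proof eventually_elim
      case (elim t)
      show ?case
      proof (cases "t \<in> {0..1}")
        case True
        with elim have "t > 0" by auto
        from mult_left_mono[OF slice[OF this], of "ennreal (2 * \<rho>)"] True
        show ?thesis by (simp add: ac_simps)
      qed simp
    qed
  qed
  also have "\<dots> = (ennreal (2 * \<rho>) * E) * (\<integral>\<^sup>+t. ennreal (t powr - (n / p)) * indicator {0..1} t \<partial>lborel)"
    by (rule nn_integral_cmult) measurable
  also have "(\<integral>\<^sup>+t. ennreal (t powr - (n / p)) * indicator {0..1} t \<partial>lborel) = ennreal (1 / (1 - n / p))"
    using np has_integral_powr_from_0[of "- (n / p)" 1]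
    by (intro nn_integral_has_integral_lebesgue') auto
  also have "(ennreal (2 * \<rho>) * E) * ennreal (1 / (1 - n / p)) = ennreal (2 * \<rho> / (1 - n / p)) * E"
    using \<rho> np by (simp add: ac_simps flip: ennreal_mult)
  finally show ?thesis
    by (simp add: E_def V_def S_def)
qed

text \<open>The triangle inequality through a third point \<open>w\<close> is averaged over a ball
  of radius \<open>dist x y\<close> about the midpoint, which contains both points. Division by its
  volume leaves \<open>\<rho> * \<rho> powr - (n / p)\<close>, the Hoelder modulus.\<close>

lemma gauss_Morrey:
  fixes c p :: real
  defines "n \<equiv> real CARD('n::finite)"
  assumes c: "c > 0" and p: "p > n"
  shows "\<exists>K>0. \<forall>u\<in>Ccinf. \<forall>x y :: real^'n.
    \<bar>u x - u y\<bar> \<le> K * dist x y powr (1 - n / p) * Lp_norm (gauss_measure c) p (\<lambda>x. norm (grad u x))"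
proof -
  define \<omega> where "\<omega> = unit_ball_vol n"
  \<comment> \<open>The 4 collects the constant 2 of \<open>Morrey_ball_average\<close> for each of
    the two points; the power of the unit ball volume \<open>\<omega>\<close> remains after division
    by the volume of the ball.\<close>
  define K where "K = 4 / (1 - n / p) * \<omega> powr - (1 / p)"
  have n1: "n \<ge> 1" by (simp add: n_def Suc_le_eq)
  have p1: "p > 1" "n / p < 1" using p n1 by auto
  have \<omega>: "\<omega> > 0" using n1 by (simp add: \<omega>_def)
  show ?thesis
  proof (intro exI[of _ K] conjI ballI allI)
    show "K > 0" using p1 \<omega> by (simp add: K_def)
    fix u :: "real^'n \<Rightarrow> real" and x y :: "real^'n" assume u: "u \<in> Ccinf"
    note [measurable] = Ccinf_measurable[OF u]
    define G where "G = Lp_norm (gauss_measure c) p (\<lambda>x. norm (grad u x))"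
    have G: "G \<ge> 0" by (simp add: G_def Lp_norm_nonneg)
    define \<rho> where "\<rho> = dist x y"
    show "\<bar>u x - u y\<bar> \<le> K * dist x y powr (1 - n / p) * G"
    proof (cases "x = y")
      case False
      then have \<rho>: "\<rho> > 0" by (simp add: \<rho>_def)
      define z where "z = midpoint x y"
      define S where "S = ball z \<rho>"
      define m where "m = \<omega> * \<rho> powr n"
      have m: "m > 0" using \<omega> \<rho> by (simp add: m_def)
      have S: "x \<in> S" "y \<in> S"
        using \<rho> by (auto simp: S_def z_def dist_midpoint \<rho>_def)
      have [measurable]: "S \<in> sets borel" by (simp add: S_def)
      have mS: "emeasure lborel S = ennreal m"
        using \<rho> by (simp add: S_def emeasure_ball m_def \<omega>_def n_def powr_realpow)
      have "(\<integral>\<^sup>+y. ennreal (norm (grad u y) powr p) \<partial>lborel) \<le> (\<integral>\<^sup>+y. ennreal (norm (grad u y) powr p) \<partial>gauss_measure c)"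
        by (rule nn_integral_lborel_le_gauss_measure[OF c]) measurable
      also have "\<dots> = ennreal (G powr p)"
        using p1 by (simp add: Ccinf_nn_integral_powr(2)[OF u] G_def Lp_norm_powr)
      finally have "epowr (\<integral>\<^sup>+y. ennreal (norm (grad u y) powr p) \<partial>lborel) (1 / p) \<le> epowr (ennreal (G powr p)) (1 / p)"
        using p1 by (intro epowr_mono) auto
      also have "\<dots> = ennreal G"
        using p1 G by (simp add: epowr_ennreal powr_powr)
      finally have V: "epowr (\<integral>\<^sup>+y. ennreal (norm (grad u y) powr p) \<partial>lborel) (1 / p) \<le> ennreal G" .
      have avg: "(\<integral>\<^sup>+w. indicator S w * ennreal \<bar>u w - u v\<bar> \<partial>lborel)
          \<le> ennreal (2 * \<rho> / (1 - n / p) * (m powr (1 - 1 / p) * G))" if "v \<in> S" for v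
      proof -
        have "(\<integral>\<^sup>+w. indicator S w * ennreal \<bar>u w - u v\<bar> \<partial>lborel)
            \<le> ennreal (2 * \<rho> / (1 - n / p)) * (epowr (emeasure lborel S) (1 - 1 / p)
              * epowr (\<integral>\<^sup>+y. ennreal (norm (grad u y) powr p) \<partial>lborel) (1 / p))"
          using that p unfolding S_def n_def by (intro Morrey_ball_average u) auto
        also have "\<dots> \<le> ennreal (2 * \<rho> / (1 - n / p)) * (epowr (ennreal m) (1 - 1 / p) * ennreal G)"
          unfolding mS by (intro mult_left_mono V) auto
        also have "\<dots> = ennreal (2 * \<rho> / (1 - n / p) * (m powr (1 - 1 / p) * G))"
        proof -
          have "0 \<le> 2 * \<rho> / (1 - n / p)" using \<rho> p1 by simp
          then show ?thesis
            by (simp only: epowr_ennreal_pos[OF m] ennreal_mult[OF powr_ge_zero G]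
                ennreal_mult[OF _ mult_nonneg_nonneg[OF powr_ge_zero G]])
        qed
        finally show ?thesis .
      qed
      have "ennreal (m * \<bar>u x - u y\<bar>) = (\<integral>\<^sup>+w. indicator S w * ennreal \<bar>u x - u y\<bar> \<partial>lborel)"
        using m mS by (simp add: nn_integral_multc ennreal_mult)
      also have "\<dots> \<le> (\<integral>\<^sup>+w. indicator S w * ennreal \<bar>u w - u x\<bar> + indicator S w * ennreal \<bar>u w - u y\<bar> \<partial>lborel)"
        by (intro nn_integral_mono) (auto simp: indicator_def simp flip: ennreal_plus intro!: ennreal_leI)
      also have "\<dots> = (\<integral>\<^sup>+w. indicator S w * ennreal \<bar>u w - u x\<bar> \<partial>lborel) + (\<integral>\<^sup>+w. indicator S w * ennreal \<bar>u w - u y\<bar> \<partial>lborel)"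
        by (rule nn_integral_add) measurable
      also have "\<dots> \<le> ennreal (2 * \<rho> / (1 - n / p) * (m powr (1 - 1 / p) * G)) + ennreal (2 * \<rho> / (1 - n / p) * (m powr (1 - 1 / p) * G))"
        by (intro add_mono avg S)
      also have "\<dots> = ennreal (4 * \<rho> / (1 - n / p) * (m powr (1 - 1 / p) * G))"
        using \<rho> p1 G by (simp flip: ennreal_plus)
      finally have "m * \<bar>u x - u y\<bar> \<le> 4 * \<rho> / (1 - n / p) * (m powr (1 - 1 / p) * G)"
        using \<rho> p1 G by (subst (asm) ennreal_le_iff) auto
      also have "m powr (1 - 1 / p) = m * m powr - (1 / p)"
        using m by (simp add: powr_diff powr_minus divide_inverse)
      finally have "m * \<bar>u x - u y\<bar> \<le> m * (4 * \<rho> / (1 - n / p) * (m powr - (1 / p) * G))"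
        by (simp add: ac_simps)
      then have "\<bar>u x - u y\<bar> \<le> 4 * \<rho> / (1 - n / p) * (m powr - (1 / p) * G)"
        by (simp only: mult_le_cancel_left_pos[OF m])
      also have "m powr - (1 / p) = \<omega> powr - (1 / p) * \<rho> powr - (n / p)"
        using \<omega> \<rho> by (simp add: m_def powr_mult powr_powr)
      also have "4 * \<rho> / (1 - n / p) * (\<omega> powr - (1 / p) * \<rho> powr - (n / p) * G) = K * (\<rho> powr 1 * \<rho> powr - (n / p)) * G"
        using \<rho> by (simp add: K_def)
      also have "\<rho> powr 1 * \<rho> powr - (n / p) = \<rho> powr (1 - n / p)"
        by (simp only: powr_add[symmetric]) simp
      finally show ?thesis by (simp add: \<rho>_def)
    qed simp
  qed
qed

section \<open>The supremum bound and the case \<open>p > n\<close>\<close>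

lemma powr_add_le:
  fixes a b p :: real
  assumes "a \<ge> 0" "b \<ge> 0" "p \<ge> 0"
  shows "(a + b) powr p \<le> 2 powr p * (a powr p + b powr p)"
proof -
  have "(a + b) powr p \<le> (2 * max a b) powr p"
    using assms by (intro powr_mono2) auto
  also have "\<dots> = 2 powr p * max a b powr p"
    using assms by (simp add: powr_mult)
  also have "\<dots> \<le> 2 powr p * (a powr p + b powr p)"
    by (intro mult_left_mono) (auto simp: max_def)
  finally show ?thesis .
qed

text \<open>Within distance 1 of \<open>x\<close> the Hoelder bound keeps \<open>u\<close> within
  \<open>K * G\<close> of \<open>u x\<close>. Averaging \<open>p\<close>-th powers over the unit
  ball about \<open>x\<close> leaves the integral of \<open>\<bar>u y\<bar> powr p\<close>, which
  the Poincare inequality controls.\<close>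

lemma gauss_sup_bound:
  fixes c p :: real
  assumes c: "c > 0" and p: "p > real CARD('n::finite)"
  shows "\<exists>K>0. \<forall>u\<in>Ccinf. \<forall>x :: real^'n.
    \<bar>u x\<bar> \<le> K * Lp_norm (gauss_measure c) p (\<lambda>x. norm (grad u x))"
proof -
  let ?M = "gauss_measure c :: (real^'n) measure"
  define n where "n = real CARD('n)"
  define \<omega> where "\<omega> = unit_ball_vol n"
  have n1: "n \<ge> 1" by (simp add: n_def Suc_le_eq)
  have "p > n" using p by (simp add: n_def)
  with n1 have p1: "p > 1" "n / p < 1" by auto
  have \<omega>: "\<omega> > 0" using n1 by (simp add: \<omega>_def)
  obtain K where K: "K > 0" "\<forall>u\<in>Ccinf. \<forall>x y :: real^'n.
      \<bar>u x - u y\<bar> \<le> K * dist x y powr (1 - n / p) * Lp_norm ?M p (\<lambda>x. norm (grad u x))"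
    using gauss_Morrey[OF c p] unfolding n_def by blast
  obtain C where C: "C > 0" "\<forall>u\<in>Ccinf. (\<integral>x. \<bar>u x\<bar> powr p \<partial>?M) \<le> C * Lp_norm ?M p (\<lambda>x. norm (grad u x)) powr p"
    using grad_controls_self[OF c, of p] p1 unfolding grad_controls_def by auto
  \<comment> \<open>The summands are the Poincare constant divided by the volume
    \<open>\<omega>\<close> of the unit ball and the oscillation over that ball;
    \<open>2 powr p\<close> is the cost of splitting the power of a sum.\<close>
  define L where "L = 2 powr p * (C / \<omega> + K powr p)"
  have L: "L > 0" using C K \<omega> by (auto simp: L_def intro!: mult_pos_pos add_pos_pos)
  show ?thesis
  proof (intro exI[of _ "L powr (1 / p)"] conjI ballI allI)
    show "L powr (1 / p) > 0" using L by simp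
    fix u :: "real^'n \<Rightarrow> real" and x :: "real^'n" assume u: "u \<in> Ccinf"
    note [measurable] = Ccinf_measurable[OF u]
    define G where "G = Lp_norm ?M p (\<lambda>x. norm (grad u x))"
    have G: "G \<ge> 0" by (simp add: G_def Lp_norm_nonneg)
    define S where "S = ball x 1"
    have [measurable]: "S \<in> sets borel" by (simp add: S_def)
    have mS: "emeasure lborel S = ennreal \<omega>"
      by (simp add: S_def emeasure_ball \<omega>_def n_def)
    have pt: "\<bar>u x\<bar> powr p \<le> 2 powr p * (\<bar>u y\<bar> powr p + (K * G) powr p)" if "y \<in> S" for y
    proof -
      have "dist x y powr (1 - n / p) \<le> 1"
        using that p1 by (intro powr_le1) (auto simp: S_def)
      then have "K * dist x y powr (1 - n / p) * G \<le> K * 1 * G"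
        using K G by (intro mult_right_mono mult_left_mono) auto
      moreover have "\<bar>u x - u y\<bar> \<le> K * dist x y powr (1 - n / p) * G"
        using K(2) u by (auto simp: G_def)
      ultimately have "\<bar>u x\<bar> \<le> \<bar>u y\<bar> + K * G" by linarith
      then have "\<bar>u x\<bar> powr p \<le> (\<bar>u y\<bar> + K * G) powr p"
        using p1 by (intro powr_mono2) auto
      also have "\<dots> \<le> 2 powr p * (\<bar>u y\<bar> powr p + (K * G) powr p)"
        using p1 K G by (intro powr_add_le) auto
      finally show ?thesis .
    qed
    have "ennreal (\<omega> * \<bar>u x\<bar> powr p) = (\<integral>\<^sup>+y. indicator S y * ennreal (\<bar>u x\<bar> powr p) \<partial>lborel)"
      using \<omega> mS by (simp add: nn_integral_multc ennreal_mult)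
    also have "\<dots> \<le> (\<integral>\<^sup>+y. ennreal (2 powr p) * (ennreal (\<bar>u y\<bar> powr p) + ennreal ((K * G) powr p) * indicator S y) \<partial>lborel)"
      using pt by (intro nn_integral_mono) (auto simp: indicator_def simp flip: ennreal_plus ennreal_mult intro!: ennreal_leI)
    also have "\<dots> = ennreal (2 powr p) * ((\<integral>\<^sup>+y. ennreal (\<bar>u y\<bar> powr p) \<partial>lborel) + ennreal ((K * G) powr p) * ennreal \<omega>)"
      using mS by (simp add: nn_integral_cmult nn_integral_add)
    also have "\<dots> \<le> ennreal (2 powr p) * (ennreal (C * G powr p) + ennreal ((K * G) powr p) * ennreal \<omega>)"
    proof (intro mult_left_mono add_right_mono)
      have "(\<integral>\<^sup>+y. ennreal (\<bar>u y\<bar> powr p) \<partial>lborel) \<le> (\<integral>\<^sup>+y. ennreal (\<bar>u y\<bar> powr p) \<partial>?M)"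
        by (rule nn_integral_lborel_le_gauss_measure[OF c]) measurable
      also have "\<dots> = ennreal (\<integral>y. \<bar>u y\<bar> powr p \<partial>?M)"
        using p1 by (intro Ccinf_nn_integral_powr u) auto
      also have "\<dots> \<le> ennreal (C * G powr p)"
        using C(2) u by (intro ennreal_leI) (auto simp: G_def)
      finally show "(\<integral>\<^sup>+y. ennreal (\<bar>u y\<bar> powr p) \<partial>lborel) \<le> ennreal (C * G powr p)" .
    qed auto
    also have "\<dots> = ennreal (2 powr p * (C * G powr p + (K * G) powr p * \<omega>))"
      using C K G \<omega> by (simp add: ennreal_mult)
    also have "2 powr p * (C * G powr p + (K * G) powr p * \<omega>) = \<omega> * (L * G powr p)"
      using \<omega> K G by (simp add: L_def powr_mult field_simps)
    finally have "\<omega> * \<bar>u x\<bar> powr p \<le> \<omega> * (L * G powr p)"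
      using \<omega> L by (subst (asm) ennreal_le_iff) auto
    then have "\<bar>u x\<bar> powr p \<le> L * G powr p" using \<omega> by simp
    then have "(\<bar>u x\<bar> powr p) powr (1 / p) \<le> (L * G powr p) powr (1 / p)"
      using p1 by (intro powr_mono2) auto
    then show "\<bar>u x\<bar> \<le> L powr (1 / p) * G"
      using p1 L G by (simp add: powr_powr powr_mult)
  qed
qed

text \<open>Interpolation between \<open>p\<close> and the supremum: the surplus power
  \<open>\<bar>u x\<bar> powr (q - p)\<close> falls under the supremum bound, and the remaining
  \<open>p\<close>-th power under the Poincare inequality.\<close>

lemma grad_controls_supercritical:
  fixes c p :: real
  assumes c: "c > 0" and p: "p > real CARD('n::finite)" and q: "q \<ge> p"
  shows "grad_controls (gauss_measure c :: (real^'n) measure) p q"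
proof -
  let ?M = "gauss_measure c :: (real^'n) measure"
  have "real CARD('n) \<ge> 1" by (simp add: Suc_le_eq)
  then have p1: "p > 1" using p by linarith
  obtain K where K: "K > 0" "\<forall>u\<in>Ccinf. \<forall>x :: real^'n. \<bar>u x\<bar> \<le> K * Lp_norm ?M p (\<lambda>x. norm (grad u x))"
    using gauss_sup_bound[OF c p] by blast
  obtain C where C: "C > 0" "\<forall>u\<in>Ccinf. (\<integral>x. \<bar>u x\<bar> powr p \<partial>?M) \<le> C * Lp_norm ?M p (\<lambda>x. norm (grad u x)) powr p"
    using grad_controls_self[OF c, of p] p1 unfolding grad_controls_def by auto
  show ?thesis
  proof (rule grad_controlsI[where C = "K powr (q - p) * C"])
    fix u :: "real^'n \<Rightarrow> real" assume u: "u \<in> Ccinf"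
    define G where "G = Lp_norm ?M p (\<lambda>x. norm (grad u x))"
    have G: "G \<ge> 0" by (simp add: G_def Lp_norm_nonneg)
    have "\<bar>u x\<bar> powr q \<le> (K * G) powr (q - p) * \<bar>u x\<bar> powr p" for x
    proof -
      have "\<bar>u x\<bar> powr (q - p) \<le> (K * G) powr (q - p)"
        using q K(2) u by (intro powr_mono2) (auto simp: G_def)
      then have "\<bar>u x\<bar> powr (q - p) * \<bar>u x\<bar> powr p \<le> (K * G) powr (q - p) * \<bar>u x\<bar> powr p"
        by (intro mult_right_mono) auto
      then show ?thesis by (simp flip: powr_add)
    qed
    then have "(\<integral>x. \<bar>u x\<bar> powr q \<partial>?M) \<le> (\<integral>x. (K * G) powr (q - p) * \<bar>u x\<bar> powr p \<partial>?M)"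
      using p1 q by (intro integral_mono integrable_mult_right Ccinf_integrable_powr u) auto
    also have "\<dots> = (K * G) powr (q - p) * (\<integral>x. \<bar>u x\<bar> powr p \<partial>?M)" by simp
    also have "\<dots> \<le> (K * G) powr (q - p) * (C * G powr p)"
      using C(2) u by (intro mult_left_mono) (auto simp: G_def)
    also have "\<dots> = K powr (q - p) * C * (G powr (q - p) * G powr p)"
      using K G by (simp add: powr_mult)
    also have "G powr (q - p) * G powr p = G powr q"
      by (simp flip: powr_add)
    finally show "(\<integral>x. \<bar>u x\<bar> powr q \<partial>?M) \<le> K powr (q - p) * C * Lp_norm ?M p (\<lambda>x. norm (grad u x)) powr q"
      by (simp add: G_def)
  qed
qed

section \<open>Supremum and Hoelder norms, and the assembly of all exponents\<close>

lemma sup_norm_le: "(\<And>x. \<bar>g x\<bar> \<le> B) \<Longrightarrow> sup_norm g \<le> B"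
  unfolding sup_norm_def by (rule cSUP_least) auto

lemma holder_norm_le:
  fixes g :: "real^'n::finite \<Rightarrow> real"
  assumes "\<And>x. \<bar>g x\<bar> \<le> A" "\<And>x y. \<bar>g x - g y\<bar> \<le> B * dist x y powr \<alpha>"
  shows "holder_norm \<alpha> g \<le> A + B"
  unfolding holder_norm_def
proof (intro add_mono sup_norm_le assms cSUP_least)
  have "(axis undefined 1, 0) \<in> {(x :: real^'n, y). x \<noteq> y}" by (simp add: axis_eq_0_iff)
  then show "{(x :: real^'n, y). x \<noteq> y} \<noteq> {}" by blast
next
  fix xy :: "(real^'n) \<times> (real^'n)" assume "xy \<in> {(x, y). x \<noteq> y}"
  then show "\<bar>g (fst xy) - g (snd xy)\<bar> / dist (fst xy) (snd xy) powr \<alpha> \<le> B"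
    using assms(2)[of "fst xy" "snd xy"] by (auto simp: divide_le_eq)
qed

theorem theorem8:
  fixes c p :: real
  assumes n2: "CARD('n::finite) \<ge> 2"
    and c: "c > 0"
    and p: "p \<ge> 1"
  defines "n \<equiv> real CARD('n)"
  defines "\<mu> \<equiv> (gauss_measure c :: (real^'n) measure)"
  shows
    "(\<forall>q::real. ((p < n \<and> p \<le> q \<and> q \<le> n * p / (n - p)) \<or> (p = n \<and> n \<le> q) \<or> (p > n \<and> p \<le> q)) \<longrightarrow>
        (\<exists>C>0. \<forall>u\<in>(Ccinf :: (real^'n \<Rightarrow> real) set).
            Lp_norm \<mu> p (\<lambda>x. norm (grad u x)) \<ge> C * Lp_norm \<mu> q u))
   \<and> (p > n \<longrightarrow> (\<exists>C>0. \<forall>u\<in>(Ccinf :: (real^'n \<Rightarrow> real) set).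
            Lp_norm \<mu> p (\<lambda>x. norm (grad u x)) \<ge> C * sup_norm u))
   \<and> (p > n \<longrightarrow> (\<exists>C>0. \<forall>u\<in>(Ccinf :: (real^'n \<Rightarrow> real) set).
            Lp_norm \<mu> p (\<lambda>x. norm (grad u x)) \<ge> C * holder_norm (1 - n / p) u))"
proof (intro conjI allI impI)
  fix q :: real
  assume q: "(p < n \<and> p \<le> q \<and> q \<le> n * p / (n - p)) \<or> (p = n \<and> n \<le> q) \<or> (p > n \<and> p \<le> q)"
  then have "grad_controls \<mu> p q"
  proof (elim disjE conjE)
    assume "p < n" "p \<le> q" "q \<le> n * p / (n - p)"
    then show ?thesis
      unfolding \<mu>_def n_def using p
      by (intro grad_controls_interpolate[OF grad_controls_self[OF c p] grad_controls_critical[OF n2 c p]]) auto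
  next
    assume "p = n" "n \<le> q"
    then show ?thesis
      unfolding \<mu>_def n_def using grad_controls_limiting[OF n2 c, of q] by simp
  next
    assume "p > n" "p \<le> q"
    then show ?thesis
      unfolding \<mu>_def n_def by (intro grad_controls_supercritical c)
  qed
  then show "\<exists>C>0. \<forall>u\<in>Ccinf. Lp_norm \<mu> p (\<lambda>x. norm (grad u x)) \<ge> C * Lp_norm \<mu> q u"
    using p q by (intro grad_controls_Lp_norm) auto
next
  \<comment> \<open>The pointwise bound gives the supremum norm, which is the case of infinite
    \<open>q\<close>, and together with the Hoelder modulus the full Hoelder norm.\<close>
  assume pn: "p > n"
  obtain K where K: "K > 0" "\<forall>u\<in>Ccinf. \<forall>x. \<bar>u x\<bar> \<le> K * Lp_norm \<mu> p (\<lambda>x. norm (grad u x))"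
    using gauss_sup_bound[OF c, of p, where 'n='n] pn unfolding \<mu>_def n_def by blast
  show "\<exists>C>0. \<forall>u\<in>Ccinf. Lp_norm \<mu> p (\<lambda>x. norm (grad u x)) \<ge> C * sup_norm u"
  proof (intro exI[of _ "1 / K"] conjI ballI)
    fix u :: "real^'n \<Rightarrow> real" assume "u \<in> Ccinf"
    then have "sup_norm u \<le> K * Lp_norm \<mu> p (\<lambda>x. norm (grad u x))"
      using K by (intro sup_norm_le) auto
    then show "Lp_norm \<mu> p (\<lambda>x. norm (grad u x)) \<ge> 1 / K * sup_norm u"
      using K by (simp add: field_simps)
  qed (use K in simp)
  obtain H where H: "H > 0" "\<forall>u\<in>Ccinf. \<forall>x y. \<bar>u x - u y\<bar> \<le> H * dist x y powr (1 - n / p) * Lp_norm \<mu> p (\<lambda>x. norm (grad u x))"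
    using gauss_Morrey[OF c, of p, where 'n='n] pn unfolding \<mu>_def n_def by blast
  show "\<exists>C>0. \<forall>u\<in>Ccinf. Lp_norm \<mu> p (\<lambda>x. norm (grad u x)) \<ge> C * holder_norm (1 - n / p) u"
  \<comment> \<open>\<open>K\<close> accounts for the supremum part of the Hoelder norm and
    \<open>H\<close> for its seminorm.\<close>
  proof (intro exI[of _ "1 / (K + H)"] conjI ballI)
    fix u :: "real^'n \<Rightarrow> real" assume u: "u \<in> Ccinf"
    define G where "G = Lp_norm \<mu> p (\<lambda>x. norm (grad u x))"
    have "holder_norm (1 - n / p) u \<le> K * G + H * G"
    proof (rule holder_norm_le)
      show "\<bar>u x\<bar> \<le> K * G" for x using K(2) u by (simp add: G_def)
      show "\<bar>u x - u y\<bar> \<le> H * G * dist x y powr (1 - n / p)" for x y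
        using H(2) u by (simp add: G_def ac_simps)
    qed
    then show "Lp_norm \<mu> p (\<lambda>x. norm (grad u x)) \<ge> 1 / (K + H) * holder_norm (1 - n / p) u"
      using K(1) H(1) by (simp add: G_def field_simps)
  qed (use K H in simp)
qed

end
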